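(* Let $n\ge 1$, let $1\le p\le 2$, and let $A$ and $B$ be self-adjoint complex $n\times n$ matrices with $A\ge |B|$. Then $$\|A+B\|_p^p+\|A-B\|_p^p\ \le\ \|\Sigma_\uparrow(A)+\Sigma_\downarrow(B)\|_p^p+\|\Sigma_\uparrow(A)-\Sigma_\downarrow(B)\|_p^p .$$
   Context: For an $n\times n$ complex matrix $X$, $|X|=\sqrt{X^*X}$ and, for $1\le p<\infty$, $\|X\|_p=(\mathrm{Tr}\,|X|^p)^{1/p}$ is the $C^p$ trace norm. $X\ge Y$ means that $X-Y$ is positive semidefinite. If $\sigma_1\ge\sigma_2\ge\dots\ge\sigma_n\ge 0$ are the singular values of $X$ (the eigenvalues of $|X|$, counted with multiplicity), then $\Sigma_\uparrow(X)=\mathrm{diag}(\sigma_1,\sigma_2,\dots,\sigma_n)$ and $\Sigma_\downarrow(X)=\mathrm{diag}(\sigma_n,\sigma_{n-1},\dots,\sigma_1)$ are the diagonal matrices with the singular values listed in these respective orders down the diagonal. *)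

theory Defs
  imports "Jordan_Normal_Form.Schur_Decomposition" "HOL-Computational_Algebra.Fundamental_Theorem_Algebra"
begin

definition mat_trace :: "'a::comm_monoid_add mat \<Rightarrow> 'a" where
  "mat_trace M = (\<Sum>i<dim_row M. M $$ (i, i))"

definition self_adjoint :: "complex mat \<Rightarrow> bool" where
  "self_adjoint M \<longleftrightarrow> square_mat M \<and> mat_adjoint M = M"

definition unitary_mat :: "complex mat \<Rightarrow> bool" where
  "unitary_mat U \<longleftrightarrow> square_mat U \<and> mat_adjoint U * U = 1\<^sub>m (dim_row U)"

definition psd :: "complex mat \<Rightarrow> bool" where
  "psd M \<longleftrightarrow> self_adjoint M \<and>
     (\<forall>v \<in> carrier_vec (dim_row M). 0 \<le> Re ((M *\<^sub>v v) \<bullet>c v))"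

text \<open>The Loewner order \<open>X \<ge> Y\<close>.\<close>

definition loewner_ge :: "complex mat \<Rightarrow> complex mat \<Rightarrow> bool" where
  "loewner_ge X Y \<longleftrightarrow> psd (X - Y)"

text \<open>The functional calculus of a self-adjoint matrix: if \<open>M = U diag(d) U*\<close> with \<open>U\<close> unitary and
  \<open>d\<close> real, then \<open>f(M) = U diag(f(d)) U*\<close>. By \<open>mat_fun_eq\<close> below the value does not depend on the
  choice of the diagonalisation. It is only meaningful for self-adjoint \<open>M\<close>.\<close>

definition mat_fun :: "(real \<Rightarrow> real) \<Rightarrow> complex mat \<Rightarrow> complex mat" where
  "mat_fun f M = (THE N. \<exists>U d. U \<in> carrier_mat (dim_row M) (dim_row M) \<and> unitary_mat U \<and>
     M = U * mat_diag (dim_row M) (\<lambda>i. complex_of_real (d i)) * mat_adjoint U \<and>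
     N = U * mat_diag (dim_row M) (\<lambda>i. complex_of_real (f (d i))) * mat_adjoint U)"

definition mat_abs :: "complex mat \<Rightarrow> complex mat" where
  "mat_abs X = mat_fun sqrt (mat_adjoint X * X)"

definition schatten_norm :: "real \<Rightarrow> complex mat \<Rightarrow> real" where
  "schatten_norm p X = Re (mat_trace (mat_fun (\<lambda>x. x powr p) (mat_abs X))) powr (1 / p)"

text \<open>The singular values in decreasing order. The eigenvalues of \<open>|X|\<close> are the roots of its
  characteristic polynomial, with multiplicity; they are real, so \<^const>\<open>Re\<close> only changes the type.\<close>

definition singular_values :: "complex mat \<Rightarrow> real list" where
  "singular_values X =
     rev (sorted_list_of_multiset (image_mset Re (proots (char_poly (mat_abs X)))))"

text \<open>Beware of the arrows: \<open>Sigma_up\<close> lists the singular values in decreasing order down the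
  diagonal, \<open>Sigma_down\<close> in increasing order.\<close>

definition Sigma_up :: "complex mat \<Rightarrow> complex mat" where
  "Sigma_up X = mat_diag (dim_row X) (\<lambda>i. complex_of_real (singular_values X ! i))"

definition Sigma_down :: "complex mat \<Rightarrow> complex mat" where
  "Sigma_down X = mat_diag (dim_row X) (\<lambda>i. complex_of_real (rev (singular_values X) ! i))"

lemma mat_adjoint_carrier:
  "U \<in> carrier_mat n n \<Longrightarrow> mat_adjoint U \<in> carrier_mat n n"
  unfolding mat_adjoint_def by auto

lemma unitary_mat_cancel:
  assumes "U \<in> carrier_mat n n" "unitary_mat U"
  shows "mat_adjoint U * U = 1\<^sub>m n" "U * mat_adjoint U = 1\<^sub>m n"
proof -
  show *: "mat_adjoint U * U = 1\<^sub>m n" using assms unfolding unitary_mat_def by auto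
  show "U * mat_adjoint U = 1\<^sub>m n"
    by (rule mat_mult_left_right_inverse[OF mat_adjoint_carrier[OF assms(1)] assms(1) *])
qed

lemma mat_fun_unique:
  fixes d e :: "nat \<Rightarrow> real" and f :: "real \<Rightarrow> real"
  assumes U: "U \<in> carrier_mat n n" "unitary_mat U" and V: "V \<in> carrier_mat n n" "unitary_mat V"
    and eq: "U * mat_diag n (\<lambda>i. complex_of_real (d i)) * mat_adjoint U
           = V * mat_diag n (\<lambda>i. complex_of_real (e i)) * mat_adjoint V"
  shows "U * mat_diag n (\<lambda>i. complex_of_real (f (d i))) * mat_adjoint U
       = V * mat_diag n (\<lambda>i. complex_of_real (f (e i))) * mat_adjoint V"
proof -
  let ?D = "\<lambda>d. mat_diag n (\<lambda>i. complex_of_real (d i))"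
  define U' where "U' = mat_adjoint U"
  define V' where "V' = mat_adjoint V"
  define W where "W = V' * U"
  have c: "U' \<in> carrier_mat n n" "V' \<in> carrier_mat n n" "W \<in> carrier_mat n n"
    using U V unfolding U'_def V'_def W_def by (auto intro!: mult_carrier_mat mat_adjoint_carrier)
  note cs = U(1) V(1) c
  have D: "?D g \<in> carrier_mat n n" for g by simp
  have assoc: "X * Y * Z = X * (Y * Z)"
    if "X \<in> carrier_mat n n" "Y \<in> carrier_mat n n" "Z \<in> carrier_mat n n" for X Y Z :: "complex mat"
    using that by (rule assoc_mult_mat)
  have mc: "X * Y \<in> carrier_mat n n"
    if "X \<in> carrier_mat n n" "Y \<in> carrier_mat n n" for X Y :: "complex mat"
    using that by (rule mult_carrier_mat)
  have one: "X * 1\<^sub>m n = X" if "X \<in> carrier_mat n n" for X :: "complex mat"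
    using that by (rule right_mult_one_mat)
  have iU: "U' * U = 1\<^sub>m n" "U * U' = 1\<^sub>m n" and iV: "V' * V = 1\<^sub>m n" "V * V' = 1\<^sub>m n"
    using unitary_mat_cancel U V unfolding U'_def V'_def by auto
  have iU2: "U' * (U * X) = X" "U * (U' * X) = X" and iV2: "V' * (V * X) = X" "V * (V' * X) = X"
    if X: "X \<in> carrier_mat n n" for X
    using X iU iV cs by (simp_all add: assoc[symmetric])
  have "W * ?D d = V' * (U * ?D d * U') * U"
    unfolding W_def using cs iU iU2 iV2 D by (simp add: assoc mc one)
  also have "\<dots> = V' * (V * ?D e * V') * U"
    using eq unfolding U'_def V'_def by simp
  also have "\<dots> = ?D e * W"
    unfolding W_def using cs iU iV2 iU2 D by (simp add: assoc mc one)
  finally have WD: "W * ?D d = ?D e * W" .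
  have "W $$ (i,j) * complex_of_real (f (d j)) = complex_of_real (f (e i)) * W $$ (i,j)"
    if ij: "i < n" "j < n" for i j
  proof -
    have "(W * ?D d) $$ (i,j) = (?D e * W) $$ (i,j)" using WD by simp
    then have "W $$ (i,j) * complex_of_real (d j) = complex_of_real (e i) * W $$ (i,j)"
      using ij cs by (simp add: mat_diag_mult_right[OF cs(5)] mat_diag_mult_left[OF cs(5)])
    then have "W $$ (i,j) = 0 \<or> d j = e i" by (simp add: mult.commute)
    then show ?thesis by auto
  qed
  then have WF: "W * ?D (\<lambda>i. f (d i)) = ?D (\<lambda>i. f (e i)) * W"
    using cs by (auto simp: mat_diag_mult_right[OF cs(5)] mat_diag_mult_left[OF cs(5)])
  have "U * ?D (\<lambda>i. f (d i)) * U' = V * (W * ?D (\<lambda>i. f (d i))) * U'"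
    unfolding W_def using cs iU iV2 iU2 D by (simp add: assoc mc one)
  also have "\<dots> = V * (?D (\<lambda>i. f (e i)) * W) * U'" by (simp only: WF)
  also have "\<dots> = V * ?D (\<lambda>i. f (e i)) * V'"
    unfolding W_def using cs iU iU2 iV2 D by (simp add: assoc mc one)
  finally show ?thesis unfolding U'_def V'_def .
qed

lemma mat_fun_eq:
  assumes U: "U \<in> carrier_mat n n" "unitary_mat U"
    and M: "M = U * mat_diag n (\<lambda>i. complex_of_real (d i)) * mat_adjoint U"
  shows "mat_fun f M = U * mat_diag n (\<lambda>i. complex_of_real (f (d i))) * mat_adjoint U"
proof -
  have n: "dim_row M = n" using U M by simp
  show ?thesis unfolding mat_fun_def n
  proof (rule the_equality, goal_cases)
    case 1
    show ?case using U M by blast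
  next
    case (2 N)
    then obtain V e where V: "V \<in> carrier_mat n n" "unitary_mat V"
      "M = V * mat_diag n (\<lambda>i. complex_of_real (e i)) * mat_adjoint V"
      "N = V * mat_diag n (\<lambda>i. complex_of_real (f (e i))) * mat_adjoint V" by blast
    show ?case unfolding V(4) by (rule mat_fun_unique[OF V(1,2) U]) (use V(3) M in simp)
  qed
qed

end

theory Submission
  imports "HOL-Analysis.Equivalence_Lebesgue_Henstock_Integration" Defs
begin

text \<open>
  Let \<open>a\<^sub>0 \<le> a\<^sub>1 \<le> \<dots>\<close> be the eigenvalues of \<open>A\<close> and \<open>b\<^sub>0, b\<^sub>1, \<dots>\<close> those of \<open>B\<close>, with \<open>\<bar>b\<^sub>k\<bar>\<close>
  decreasing. Both \<open>A + B\<close> and \<open>A - B\<close> are positive semidefinite because \<open>A \<ge> \<bar>B\<bar>\<close>, and the right-hand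
  side is \<open>\<Sum>k. g(a\<^sub>k, \<bar>b\<^sub>k\<bar>)\<close> with \<open>g(a, b) = \<bar>b + a\<bar>\<^sup>p + \<bar>b - a\<bar>\<^sup>p\<close>. Some differences
  \<open>a\<^sub>k - \<bar>b\<^sub>k\<bar>\<close> may be negative, so \<open>g(a\<^sub>k, \<bar>b\<^sub>k\<bar>)\<close> is not always given by the power series of
  \<open>(a\<^sub>k \<plusminus> \<bar>b\<^sub>k\<bar>)\<^sup>p\<close> in \<open>\<bar>b\<^sub>k\<bar>\<close>, and a term-by-term comparison of series in \<open>B\<close> fails.

  Instead, \<open>B\<close> grows from \<open>0\<close>: let \<open>B\<^sub>s\<close> be \<open>B\<close> with its eigenvalues cut off to \<open>[-s, s]\<close>. At \<open>s = 0\<close>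
  the two sides agree, so it is enough to compare their growth rates (\<open>trace_power_rearrangement\<close>, by
  way of \<open>increment_comparison\<close>). With \<open>r = p - 1\<close>, convexity of the \<open>p\<close>-th power bounds the growth of
  the left-hand side by \<open>p\<close> times a weighted trace of \<open>(A + B\<^sub>s)\<^sup>r - (A - B\<^sub>s)\<^sup>r\<close> in the eigenbasis of
  \<open>B\<close> (\<open>trace_power_increment\<close>), while the right-hand side grows with the slopes \<open>\<partial>g/\<partial>b\<close>. The claim about
  growth rates (\<open>power_difference_bound\<close>) is that the weighted trace is at most the sum, with the same weights,
  of \<open>(m\<^sub>k + s)\<^sup>r - (m\<^sub>k - s)\<^sup>r\<close>, where \<open>m\<^sub>k = max(a\<^sub>k, s)\<close>. For \<open>a\<^sub>k \<ge> s\<close> this term is exactly \<open>1/p\<close> times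
  the slope of \<open>g\<close> at \<open>(a\<^sub>k, s)\<close>; for \<open>a\<^sub>k < s\<close> it is \<open>(2s)\<^sup>r\<close>, which is at most that number since
  \<open>x \<mapsto> x\<^sup>r\<close> is subadditive. The cut-off provides the bound \<open>\<bar>B\<^sub>s\<bar> \<le> s\<close>.

  For \<open>0 < r < 1\<close> the power \<open>x\<^sup>r\<close> is a positive mixture of the functions \<open>x / (t + x)\<close>, \<open>t > 0\<close>, so
  resolvents \<open>R(M) = (t + M)\<^sup>-\<^sup>1\<close> may replace powers. Inversion is order reversing, and
  \<open>A - \<bar>B\<^sub>s\<bar> \<le> A \<plusminus> B\<^sub>s \<le> A + \<bar>B\<^sub>s\<bar>\<close>, so \<open>W = R(A - \<bar>B\<^sub>s\<bar>) - R(A + \<bar>B\<^sub>s\<bar>)\<close> dominates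
  \<open>\<plusminus>(R(A - B\<^sub>s) - R(A + B\<^sub>s))\<close>; this is the place where \<open>A \<ge> \<bar>B\<bar>\<close>, and not only \<open>A \<ge> \<plusminus>B\<close>, is used. The
  eigenvalues of \<open>W\<close> are bounded one by one: always by \<open>1/t - 1/(t + 2s)\<close>, and, when \<open>a\<^sub>k \<ge> s\<close>, the
  \<open>k\<close>-th largest one by \<open>1/(t + a\<^sub>k - s) - 1/(t + a\<^sub>k + s)\<close>. The second bound is the heart of the proof
  (\<open>resolvent_difference_eigenvalue_bound\<close>): \<open>A - s\<close> need not be positive, so \<open>A - \<bar>B\<^sub>s\<bar> \<ge> A - s\<close> cannot
  be inverted as an operator inequality, but it can be inverted on a subspace of the right codimension.

  The cases \<open>p = 1\<close> and \<open>p = 2\<close> follow by continuity in \<open>p\<close>.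
\<close>

unbundle no vec_syntax
unbundle no inner_syntax


section \<open>Powers and resolvents of real numbers\<close>

text \<open>
  The substitution \<open>t = x u\<close> pulls the factor \<open>x\<^sup>r\<close> out of the integral. The integral at \<open>x = 1\<close> converges
  because its integrand is at most \<open>t\<^sup>r\<^sup>-\<^sup>1\<close> near \<open>0\<close> and at most \<open>t\<^sup>r\<^sup>-\<^sup>2\<close> near infinity.
\<close>

lemma powr_resolvent_integral:
  fixes r :: real
  assumes "0 < r" "r < 1"
  obtains K where "K > 0" 
    "\<And>x. x \<ge> 0 \<Longrightarrow> has_bochner_integral lborel
       (\<lambda>t. indicator {0<..} t * (t powr (r - 1) * (x / (t + x)))) (K * x powr r)"
proof -
  define F :: "real \<Rightarrow> real \<Rightarrow> real" where
    "F x t = indicator {0<..} t * (t powr (r - 1) * (x / (t + x)))" for x t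
  have [measurable]: "F x \<in> borel_measurable borel" for x
    unfolding F_def by measurable
  have nonneg: "F 1 t \<ge> 0" for t unfolding F_def by (auto split: split_indicator)
  define G1 :: "real \<Rightarrow> real" where "G1 t = indicator {0..1} t * t powr (r - 1)" for t
  define G2 :: "real \<Rightarrow> real" where "G2 t = indicator {1..} t * t powr (r - 2)" for t
  have [measurable]: "G1 \<in> borel_measurable borel" "G2 \<in> borel_measurable borel"
    unfolding G1_def G2_def by measurable
  have G0: "G1 t \<ge> 0" "G2 t \<ge> 0" for t unfolding G1_def G2_def by auto
  have i1: "((\<lambda>t. t powr (r - 1)) has_integral 1 / r) {0..1}"
    using has_integral_powr_from_0[of "r - 1" 1] assms by simp
  have e1: "G1 = (\<lambda>t. if t \<in> {0..1} then t powr (r - 1) else 0)"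
    unfolding G1_def by (auto split: split_indicator)
  have "(G1 has_integral 1 / r) UNIV" unfolding e1 has_integral_restrict_UNIV by (rule i1)
  from nn_integral_has_integral_lborel[OF _ G0(1) this] have n1: "integral\<^sup>N lborel G1 = 1 / r"
    by simp
  have i2: "((\<lambda>t. t powr (r - 2)) has_integral - 1 / (r - 1)) {1..}"
    using has_integral_powr_to_inf[of "r - 2" 1] assms by simp
  have e2: "G2 = (\<lambda>t. if t \<in> {1..} then t powr (r - 2) else 0)"
    unfolding G2_def by (auto split: split_indicator)
  have "(G2 has_integral - 1 / (r - 1)) UNIV" unfolding e2 has_integral_restrict_UNIV by (rule i2)
  from nn_integral_has_integral_lborel[OF _ G0(2) this] have n2: "integral\<^sup>N lborel G2 = - 1 / (r - 1)"
    by simp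
  have bound: "F 1 t \<le> G1 t + G2 t" for t
  proof -
    consider "t \<le> 0" | "0 < t" "t \<le> 1" | "t > 1" by linarith
    then show ?thesis
    proof cases
      case 1 then show ?thesis using G0[of t] by (simp add: F_def)
    next
      case 2
      have "t powr (r - 1) * (1 / (t + 1)) \<le> t powr (r - 1) * 1"
        using 2 by (intro mult_left_mono) auto
      then show ?thesis using 2 G0(2)[of t] by (simp add: F_def G1_def)
    next
      case 3
      have "t powr (r - 1) * (1 / (t + 1)) \<le> t powr (r - 1) * (1 / t)"
        using 3 by (intro mult_left_mono) (auto simp: field_simps)
      also have "\<dots> = t powr (r - 2)"
        using 3 powr_diff[of t "r - 1" 1] by simp
      finally show ?thesis using 3 G0(1)[of t] by (simp add: F_def G2_def)
    qed
  qed
  have int: "integrable lborel (F 1)"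
  proof (rule integrableI_bounded)
    have "(\<integral>\<^sup>+ t. ennreal (norm (F 1 t)) \<partial>lborel) \<le> (\<integral>\<^sup>+ t. ennreal (G1 t) + ennreal (G2 t) \<partial>lborel)"
      using bound nonneg G0 by (intro nn_integral_mono) (simp flip: ennreal_plus)
    also have "\<dots> = integral\<^sup>N lborel G1 + integral\<^sup>N lborel G2"
      by (intro nn_integral_add) simp_all
    also have "\<dots> < \<infinity>" unfolding n1 n2 by simp
    finally show "(\<integral>\<^sup>+ t. ennreal (norm (F 1 t)) \<partial>lborel) < \<infinity>" .
  qed simp
  define K where "K = integral\<^sup>L lborel (F 1)"
  have hK: "has_bochner_integral lborel (F 1) K" unfolding K_def using int by (rule has_bochner_integral_integrable)
  have "0 < (1/6::real)" by simp
  also have "(1/6::real) = integral\<^sup>L lborel (\<lambda>t. (1/6) * indicator {1..2::real} t)" by simp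
  also have "\<dots> \<le> K" unfolding K_def
  proof (intro integral_mono int)
    show "integrable lborel (\<lambda>t. (1/6) * indicator {1..2::real} t :: real)" by simp
    fix t :: real
    show "(1/6) * indicator {1..2::real} t \<le> F 1 t"
    proof (cases "t \<in> {1..2}")
      case True
      have "(1/2::real) = 2 powr (-1)" by (simp add: powr_minus)
      also have "\<dots> \<le> t powr (- 1)" using True by (simp add: powr_minus field_simps)
      also have "\<dots> \<le> t powr (r - 1)" using True assms by (intro powr_mono) auto
      finally have "1/2 * (1/3) \<le> t powr (r - 1) * (1 / (t + 1))"
        using True by (intro mult_mono) (auto simp: field_simps)
      then show ?thesis using True by (simp add: F_def)
    qed (use nonneg in auto)
  qed
  finally have "K > 0" .
  moreover have "has_bochner_integral lborel (F x) (K * x powr r)" if "x \<ge> 0" for x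
  proof (cases "x = 0")
    case True then show ?thesis using has_bochner_integral_zero[of lborel] by (simp add: F_def[abs_def])
  next
    case False
    with that have x: "x > 0" by simp
    have "F x (0 + x * u) = x powr (r - 1) * F 1 u" for u
    proof (cases "u > 0")
      case True
      have "x / (x * u + x) = x / (x * (u + 1))" by (simp add: distrib_left)
      also have "\<dots> = 1 / (u + 1)" using x by simp
      finally show ?thesis using x True by (simp add: F_def powr_mult)
    qed (use x in \<open>simp add: F_def zero_less_mult_iff\<close>)
    then have eq: "(\<lambda>u. F x (0 + x * u)) = (\<lambda>u. x powr (r - 1) * F 1 u)" by blast
    have "has_bochner_integral lborel (\<lambda>u. x powr (r - 1) * F 1 u) (x powr (r - 1) * K)"
      using hK by (intro has_bochner_integral_mult_right) auto
    moreover have "x powr (r - 1) * K = (K * x powr r) /\<^sub>R \<bar>x\<bar>"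
      using x by (simp add: powr_diff divide_inverse)
    ultimately show ?thesis
      using lborel_has_bochner_integral_real_affine_iff[of x "F x" "K * x powr r" 0] x eq by simp
  qed
  ultimately show ?thesis using that unfolding F_def by blast
qed

lemma has_bochner_integral_le:
  fixes f g :: "'a \<Rightarrow> real"
  assumes "has_bochner_integral M f a" "has_bochner_integral M g b" "\<And>t. f t \<le> g t"
  shows "a \<le> b"
  using integral_mono[of M f g] assms unfolding has_bochner_integral_iff by auto

lemma powr_le_from_resolvent_le:
  fixes r :: real and c x :: "'i \<Rightarrow> real" and e y :: "'j \<Rightarrow> real"
  assumes "0 < r" "r < 1"
    and x: "\<And>i. i \<in> I \<Longrightarrow> x i \<ge> 0" and y: "\<And>j. j \<in> J \<Longrightarrow> y j \<ge> 0"
    and le: "\<And>t. t > 0 \<Longrightarrow> (\<Sum>i\<in>I. c i * (x i / (t + x i))) \<le> (\<Sum>j\<in>J. e j * (y j / (t + y j)))"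
  shows "(\<Sum>i\<in>I. c i * x i powr r) \<le> (\<Sum>j\<in>J. e j * y j powr r)"
proof -
  obtain K where "K > 0" and K: "\<And>x. x \<ge> 0 \<Longrightarrow> has_bochner_integral lborel
       (\<lambda>t. indicator {0<..} t * (t powr (r - 1) * (x / (t + x)))) (K * x powr r)"
    using powr_resolvent_integral[OF assms(1,2)] by blast
  let ?k = "\<lambda>x t. indicator {0<..} t * (t powr (r - 1) * (x / (t + x)))"
  have sumK: "has_bochner_integral lborel (\<lambda>t. \<Sum>i\<in>I. c i * ?k (x i) t) (\<Sum>i\<in>I. c i * (K * x i powr r))"
    if "\<And>i. i \<in> I \<Longrightarrow> x i \<ge> 0" for I :: "'k set" and c x
    using that by (intro has_bochner_integral_sum has_bochner_integral_mult_right K) auto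
  have sumk: "(\<Sum>i\<in>I. c i * ?k (x i) t)
      = indicator {0<..} t * t powr (r - 1) * (\<Sum>i\<in>I. c i * (x i / (t + x i)))" for I :: "'k set" and c x t
    by (simp add: sum_distrib_left mult_ac)
  have "(\<Sum>i\<in>I. c i * (K * x i powr r)) \<le> (\<Sum>j\<in>J. e j * (K * y j powr r))"
  proof (rule has_bochner_integral_le[OF sumK[of I x c] sumK[of J y e]])
    show "\<And>i. i \<in> I \<Longrightarrow> x i \<ge> 0" "\<And>j. j \<in> J \<Longrightarrow> y j \<ge> 0" by fact+
    fix t :: real
    show "(\<Sum>i\<in>I. c i * ?k (x i) t) \<le> (\<Sum>j\<in>J. e j * ?k (y j) t)"
      unfolding sumk using le[of t] by (cases "t > 0") (auto intro: mult_left_mono)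
  qed
  then have "K * (\<Sum>i\<in>I. c i * x i powr r) \<le> K * (\<Sum>j\<in>J. e j * y j powr r)"
    by (simp add: sum_distrib_left mult_ac)
  then show ?thesis using \<open>K > 0\<close> by simp
qed

text \<open>
  A dual certificate replaces Birkhoff's theorem: there are \<open>u\<close> and \<open>v\<close> with \<open>w\<^sub>i l\<^sub>j \<le> u\<^sub>i + v\<^sub>j\<close> and
  equality for \<open>i = j\<close>, and \<open>\<Sum>(u\<^sub>i + v\<^sub>j) D\<^sub>i\<^sub>j\<close> does not depend on the doubly stochastic \<open>D\<close>.
\<close>

lemma doubly_stochastic_rearrangement:
  fixes w l :: "nat \<Rightarrow> real" and D :: "nat \<Rightarrow> nat \<Rightarrow> real"
  assumes w: "\<And>i j. i \<le> j \<Longrightarrow> j < n \<Longrightarrow> w j \<le> w i"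
    and l: "\<And>i j. i \<le> j \<Longrightarrow> j < n \<Longrightarrow> l j \<le> l i"
    and D: "\<And>i j. i < n \<Longrightarrow> j < n \<Longrightarrow> D i j \<ge> 0"
    and rows: "\<And>i. i < n \<Longrightarrow> (\<Sum>j<n. D i j) = 1"
    and cols: "\<And>j. j < n \<Longrightarrow> (\<Sum>i<n. D i j) = 1"
  shows "(\<Sum>i<n. \<Sum>j<n. w i * l j * D i j) \<le> (\<Sum>i<n. w i * l i)"
proof -
  \<comment> \<open>The discrete analogue of the integral of \<open>w dl\<close>; the certificate is \<open>u i = w i * l i - v i\<close>.\<close>
  define v where "v j = - (\<Sum>m<j. w m * (l m - l (Suc m)))" for j
  have bnd: "w k * (l j - l k) \<le> v j - v k \<and> v j - v k \<le> w j * (l j - l k)" if "j \<le> k" "k < n" for j k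
    using that
  proof (induction k rule: dec_induct)
    case base then show ?case by simp
  next
    case (step m)
    have m: "w m * (l j - l m) \<le> v j - v m" "v j - v m \<le> w j * (l j - l m)" using step by auto
    have v: "v j - v (Suc m) = (v j - v m) + w m * (l m - l (Suc m))" by (simp add: v_def)
    have "w (Suc m) * (l j - l m) \<le> w m * (l j - l m)" "w (Suc m) * (l m - l (Suc m)) \<le> w m * (l m - l (Suc m))"
      "w m * (l m - l (Suc m)) \<le> w j * (l m - l (Suc m))"
      using step.hyps step.prems w[of m "Suc m"] w[of j m] l[of j m] l[of m "Suc m"]
      by (simp_all add: mult_right_mono)
    with m v show ?case by (simp add: right_diff_distrib)
  qed
  have young: "w k * l j - w k * l k \<le> v j - v k" if "j < n" "k < n" for j k
    using bnd[of j k] bnd[of k j] that by (cases "j \<le> k") (simp_all add: right_diff_distrib)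
  have "(\<Sum>i<n. \<Sum>j<n. w i * l j * D i j)
      \<le> (\<Sum>i<n. \<Sum>j<n. (w i * l i - v i) * D i j + v j * D i j)"
  proof (intro sum_mono)
    fix i j assume "i \<in> {..<n}" "j \<in> {..<n}"
    then have "w i * l j \<le> (w i * l i - v i) + v j" "D i j \<ge> 0" using young[of j i] D[of i j] by auto
    from mult_right_mono[OF this] show "w i * l j * D i j \<le> (w i * l i - v i) * D i j + v j * D i j"
      by (simp add: distrib_right)
  qed
  also have "\<dots> = (\<Sum>i<n. (w i * l i - v i) * (\<Sum>j<n. D i j)) + (\<Sum>j<n. v j * (\<Sum>i<n. D i j))"
    by (simp add: sum.distrib sum_distrib_left) (rule sum.swap)
  also have "\<dots> = (\<Sum>i<n. w i * l i)" using rows cols by (simp add: sum_subtractf)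
  finally show ?thesis .
qed

text \<open>The odd extension of the power function; \<open>p * signed_powr (p - 1)\<close> is the derivative of \<open>\<bar>x\<bar>\<^sup>p\<close>.\<close>

definition signed_powr :: "real \<Rightarrow> real \<Rightarrow> real" where
  "signed_powr r x = sgn x * \<bar>x\<bar> powr r"

lemma signed_powr_mono:
  assumes "r > 0" "x \<le> y" shows "signed_powr r x \<le> signed_powr r y"
proof -
  consider "x \<ge> 0" | "x < 0" "y \<ge> 0" | "y < 0" by linarith
  then show ?thesis
  proof cases
    case 1 then show ?thesis using assms by (cases "x = 0") (auto simp: signed_powr_def sgn_if intro: powr_mono2)
  next
    case 2 then have "signed_powr r x \<le> 0" "signed_powr r y \<ge> 0" by (auto simp: signed_powr_def sgn_if)
    then show ?thesis by simp
  next
    case 3 then show ?thesis using assms by (auto simp: signed_powr_def sgn_if intro: powr_mono2)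
  qed
qed

text \<open>
  The graph of the convex function \<open>\<bar>x\<bar>\<^sup>p\<close> lies above its tangents. This is Young's inequality for the
  product of \<open>\<bar>y\<bar>\<close> and \<open>\<bar>x\<bar>\<^sup>p\<^sup>-\<^sup>1\<close>.
\<close>

lemma abs_powr_tangent:
  fixes p x y :: real
  assumes "1 < p"
  shows "\<bar>x\<bar> powr p + p * signed_powr (p - 1) x * (y - x) \<le> \<bar>y\<bar> powr p"
proof -
  define q where "q = p / (p - 1)"
  have q: "q > 1" "1 / p + 1 / q = 1" "(p - 1) * q = p" using assms by (auto simp: q_def field_simps)
  have "\<bar>y\<bar> * \<bar>x\<bar> powr (p - 1) \<le> \<bar>y\<bar> powr p / p + (\<bar>x\<bar> powr (p - 1)) powr q / q"
    using assms q by (intro Youngs_inequality) auto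
  also have "(\<bar>x\<bar> powr (p - 1)) powr q = \<bar>x\<bar> powr p" using q by (simp add: powr_powr)
  finally have "p * (\<bar>y\<bar> * \<bar>x\<bar> powr (p - 1)) \<le> p * (\<bar>y\<bar> powr p / p + \<bar>x\<bar> powr p / q)"
    using assms by simp
  also have "\<dots> = \<bar>y\<bar> powr p + (p - 1) * \<bar>x\<bar> powr p"
    using assms by (simp add: q_def field_simps)
  finally have Y: "p * (\<bar>y\<bar> * \<bar>x\<bar> powr (p - 1)) \<le> \<bar>y\<bar> powr p + (p - 1) * \<bar>x\<bar> powr p" .
  have xx: "signed_powr (p - 1) x * x = \<bar>x\<bar> powr p"
    using assms by (auto simp: signed_powr_def sgn_if powr_diff)
  have "signed_powr (p - 1) x * y \<le> \<bar>y\<bar> * \<bar>x\<bar> powr (p - 1)"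
    using mult_right_mono[of y "\<bar>y\<bar>" "\<bar>x\<bar> powr (p - 1)"] mult_right_mono[of "- y" "\<bar>y\<bar>" "\<bar>x\<bar> powr (p - 1)"]
    by (cases "x < 0"; cases "x = 0") (simp_all add: signed_powr_def mult_ac)
  then have "p * (signed_powr (p - 1) x * y) \<le> p * (\<bar>y\<bar> * \<bar>x\<bar> powr (p - 1))"
    using assms by (intro mult_left_mono) auto
  with Y xx show ?thesis by (simp add: algebra_simps)
qed

lemma powr_subadditive:
  fixes u v r :: real
  assumes "u \<ge> 0" "v \<ge> 0" "0 < r" "r \<le> 1"
  shows "(u + v) powr r \<le> u powr r + v powr r"
proof (cases "u + v = 0")
  case False
  then have s: "u + v > 0" using assms by simp
  have *: "z / (u + v) \<le> (z / (u + v)) powr r" if "0 \<le> z" "z \<le> u + v" for z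
  proof (cases "z = 0")
    case False
    then have "0 < z / (u + v)" "z / (u + v) \<le> 1" using that s by auto
    then show ?thesis using powr_mono'[of r 1 "z / (u + v)"] assms powr_one[of "z / (u + v)"] by linarith
  qed simp
  have "1 = u / (u + v) + v / (u + v)" using s by (simp flip: add_divide_distrib)
  also have "\<dots> \<le> (u / (u + v)) powr r + (v / (u + v)) powr r"
    using assms by (intro add_mono *) auto
  also have "\<dots> = (u powr r + v powr r) / (u + v) powr r"
    using assms s by (simp add: powr_divide add_divide_distrib)
  finally show ?thesis using s by (simp add: field_simps)
qed (use assms in simp)

text \<open>
  Comparing derivatives without differentiability. The error terms telescope over a partition of
  \<open>[0, S]\<close> into equal steps of length \<open>h\<close> to \<open>h (E S - E 0)\<close>, which vanishes as \<open>h \<rightarrow> 0\<close>.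
\<close>

lemma increment_comparison:
  fixes L R E :: "real \<Rightarrow> real"
  assumes "S \<ge> 0" and step: "\<And>x y. 0 \<le> x \<Longrightarrow> x < y \<Longrightarrow> y \<le> S \<Longrightarrow>
     L y - L x \<le> R y - R x + (y - x) * (E y - E x)"
  shows "L S - L 0 \<le> R S - R 0"
proof (cases "S = 0")
  case False
  with assms have S: "S > 0" by simp
  have bound: "L S - L 0 \<le> R S - R 0 + S * (E S - E 0) * inverse (real (Suc m))" for m
  proof -
    define h where "h = S / real (Suc m)"
    have h: "h > 0" "real (Suc m) * h = S" using S by (auto simp: h_def)
    have "L (real k * h) - L 0 \<le> R (real k * h) - R 0 + h * (E (real k * h) - E 0)" if "k \<le> Suc m" for k
      using that
    proof (induction k)
      case (Suc k)
      have "real (Suc k) * h \<le> real (Suc m) * h" using Suc.prems h by (intro mult_right_mono) auto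
      then have "L (real (Suc k) * h) - L (real k * h) \<le> R (real (Suc k) * h) - R (real k * h)
         + (real (Suc k) * h - real k * h) * (E (real (Suc k) * h) - E (real k * h))"
        using h by (intro step) (auto simp: mult_strict_right_mono)
      also have "real (Suc k) * h - real k * h = h" by (simp add: algebra_simps)
      finally show ?case using Suc by (simp add: algebra_simps)
    qed simp
    from this[of "Suc m"] have "L S - L 0 \<le> R S - R 0 + h * (E S - E 0)" using h(2) by simp
    then show ?thesis by (simp add: h_def divide_inverse mult_ac)
  qed
  have "(\<lambda>m. R S - R 0 + S * (E S - E 0) * inverse (real (Suc m))) \<longlonglongrightarrow> R S - R 0 + S * (E S - E 0) * 0"
    by (intro tendsto_intros LIMSEQ_inverse_real_of_nat)
  then show ?thesis using bound by (intro LIMSEQ_le_const[where X="\<lambda>m. R S - R 0 + S * (E S - E 0) * inverse (real (Suc m))"]) auto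
qed simp


section \<open>Quadratic forms and the spectral theorem\<close>

lemma mat_adjoint_dim [simp]: "dim_row (mat_adjoint A) = dim_col A" "dim_col (mat_adjoint A) = dim_row A"
  unfolding mat_adjoint_def by auto

lemma mat_adjoint_index [simp]:
  fixes A :: "complex mat"
  shows "i < dim_col A \<Longrightarrow> j < dim_row A \<Longrightarrow> mat_adjoint A $$ (i, j) = cnj (A $$ (j, i))"
  unfolding mat_adjoint_def by (simp add: mat_of_rows_index)

lemma mat_adjoint_mult:
  fixes A B :: "complex mat"
  assumes "A \<in> carrier_mat n m" "B \<in> carrier_mat m k"
  shows "mat_adjoint (A * B) = mat_adjoint B * mat_adjoint A"
  using assms by (intro eq_matI) (auto simp: scalar_prod_def mult.commute)

lemma mat_adjoint_adjoint [simp]: "mat_adjoint (mat_adjoint A) = (A :: complex mat)"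
  by (intro eq_matI) auto

lemma mat_adjoint_add:
  fixes A B :: "complex mat"
  assumes "A \<in> carrier_mat n m" "B \<in> carrier_mat n m"
  shows "mat_adjoint (A + B) = mat_adjoint A + mat_adjoint B"
  using assms by (intro eq_matI) auto

lemma mat_adjoint_minus:
  fixes A B :: "complex mat"
  assumes "A \<in> carrier_mat n m" "B \<in> carrier_mat n m"
  shows "mat_adjoint (A - B) = mat_adjoint A - mat_adjoint B"
  using assms by (intro eq_matI) auto

lemma mat_adjoint_real_diag [simp]:
  "mat_adjoint (mat_diag n (\<lambda>i. complex_of_real (d i))) = mat_diag n (\<lambda>i. complex_of_real (d i))"
  by (intro eq_matI) (auto simp: mat_diag_def)

lemma cscalar_prod_sum: "v \<bullet>c w = (\<Sum>i<dim_vec w. v $ i * cnj (w $ i))"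
  for v w :: "complex vec"
  by (simp add: scalar_prod_def atLeast0LessThan)

lemma mult_mat_vec_adjoint:
  fixes M :: "complex mat"
  assumes "M \<in> carrier_mat n m" "x \<in> carrier_vec m" "y \<in> carrier_vec n"
  shows "(M *\<^sub>v x) \<bullet>c y = x \<bullet>c (mat_adjoint M *\<^sub>v y)"
proof -
  have "(M *\<^sub>v x) \<bullet>c y = (\<Sum>i<n. \<Sum>k<m. M $$ (i, k) * x $ k * cnj (y $ i))"
    using assms by (simp add: cscalar_prod_sum scalar_prod_def sum_distrib_right atLeast0LessThan)
  also have "\<dots> = (\<Sum>k<m. \<Sum>i<n. M $$ (i, k) * x $ k * cnj (y $ i))" by (rule sum.swap)
  also have "\<dots> = x \<bullet>c (mat_adjoint M *\<^sub>v y)"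
    using assms by (simp add: cscalar_prod_sum scalar_prod_def sum_distrib_left atLeast0LessThan mult_ac)
  finally show ?thesis .
qed

definition sqnorm :: "complex vec \<Rightarrow> real" where
  "sqnorm v = (\<Sum>i<dim_vec v. (cmod (v $ i))\<^sup>2)"

definition qform :: "complex mat \<Rightarrow> complex vec \<Rightarrow> real" where
  "qform M v = Re ((M *\<^sub>v v) \<bullet>c v)"

definition spectral_decomp :: "nat \<Rightarrow> complex mat \<Rightarrow> (nat \<Rightarrow> real) \<Rightarrow> complex mat \<Rightarrow> bool" where
  "spectral_decomp n U d M \<longleftrightarrow> U \<in> carrier_mat n n \<and> unitary_mat U \<and>
     M = U * mat_diag n (\<lambda>i. complex_of_real (d i)) * mat_adjoint U"

lemma sqnorm_eq: "complex_of_real (sqnorm v) = v \<bullet>c v"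
  by (simp add: sqnorm_def cscalar_prod_sum complex_mult_cnj cmod_power2)

lemma sqnorm_pos:
  assumes "v \<in> carrier_vec n" "v \<noteq> 0\<^sub>v n" shows "sqnorm v > 0"
proof -
  from assms obtain i where i: "i < n" "v $ i \<noteq> 0" by (auto simp: vec_eq_iff)
  have "0 < (cmod (v $ i))\<^sup>2" using i by simp
  also have "\<dots> \<le> sqnorm v" unfolding sqnorm_def using i assms
    by (intro member_le_sum) auto
  finally show ?thesis .
qed

lemma qform_add:
  assumes "M \<in> carrier_mat n n" "N \<in> carrier_mat n n" "v \<in> carrier_vec n"
  shows "qform (M + N) v = qform M v + qform N v"
  using assms unfolding qform_def
  by (subst add_mult_distrib_mat_vec[of _ n n]) (auto simp: cscalar_prod_sum sum.distrib distrib_right)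

lemma qform_minus:
  assumes "M \<in> carrier_mat n n" "N \<in> carrier_mat n n" "v \<in> carrier_vec n"
  shows "qform (M - N) v = qform M v - qform N v"
  using assms unfolding qform_def
  by (subst minus_mult_distrib_mat_vec[of _ n n]) (auto simp: cscalar_prod_sum sum_subtractf left_diff_distrib)

lemma unitary_cscalar:
  assumes U: "U \<in> carrier_mat n n" "unitary_mat U" and v: "v \<in> carrier_vec n" "w \<in> carrier_vec n"
  shows "(mat_adjoint U *\<^sub>v v) \<bullet>c (mat_adjoint U *\<^sub>v w) = v \<bullet>c w"
proof -
  have a: "mat_adjoint U \<in> carrier_mat n n" using U mat_adjoint_carrier by blast
  have "(mat_adjoint U *\<^sub>v v) \<bullet>c (mat_adjoint U *\<^sub>v w) = v \<bullet>c (U *\<^sub>v (mat_adjoint U *\<^sub>v w))"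
    using mult_mat_vec_adjoint[OF a v(1), of "mat_adjoint U *\<^sub>v w"] a v by simp
  also have "U *\<^sub>v (mat_adjoint U *\<^sub>v w) = w"
    using assoc_mult_mat_vec[OF U(1) a v(2)] unitary_mat_cancel[OF U] v by simp
  finally show ?thesis .
qed

lemma unitary_sqnorm:
  assumes U: "U \<in> carrier_mat n n" "unitary_mat U" and v: "v \<in> carrier_vec n"
  shows "sqnorm (mat_adjoint U *\<^sub>v v) = sqnorm v"
  using unitary_cscalar[OF U v v] by (simp flip: sqnorm_eq)

lemma spectral_decompD:
  assumes "spectral_decomp n U d M"
  shows "U \<in> carrier_mat n n" "unitary_mat U" "mat_adjoint U \<in> carrier_mat n n" "M \<in> carrier_mat n n"
    "M = U * mat_diag n (\<lambda>i. complex_of_real (d i)) * mat_adjoint U"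
  using assms mat_adjoint_carrier unfolding spectral_decomp_def by auto

lemma spectral_decomp_self_adjoint:
  assumes "spectral_decomp n U d M" shows "self_adjoint M"
proof -
  note c = spectral_decompD[OF assms]
  have "mat_adjoint M = U * (mat_diag n (\<lambda>i. complex_of_real (d i)) * mat_adjoint U)"
    unfolding c(5) using c by (simp add: mat_adjoint_mult[of _ n n _ n])
  also have "\<dots> = M" unfolding c(5) using c by (simp add: assoc_mult_mat[of _ n n _ n _ n])
  finally show ?thesis using c(4) by (simp add: self_adjoint_def)
qed

lemma spectral_decomp_coord:
  assumes "spectral_decomp n U d M" and v: "v \<in> carrier_vec n" and i: "i < n"
  shows "(mat_adjoint U *\<^sub>v (M *\<^sub>v v)) $ i = complex_of_real (d i) * (mat_adjoint U *\<^sub>v v) $ i"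
proof -
  note c = spectral_decompD[OF assms(1)]
  let ?D = "mat_diag n (\<lambda>i. complex_of_real (d i))"
  have "mat_adjoint U * M = (mat_adjoint U * U) * (?D * mat_adjoint U)"
    unfolding c(5) using c by (simp add: assoc_mult_mat[of _ n n _ n _ n] mult_carrier_mat[of _ n n])
  also have "\<dots> = ?D * mat_adjoint U" using unitary_mat_cancel[OF c(1,2)] c
    by (simp add: left_mult_one_mat[of _ n n] mult_carrier_mat[of _ n n])
  finally have "mat_adjoint U *\<^sub>v (M *\<^sub>v v) = ?D *\<^sub>v (mat_adjoint U *\<^sub>v v)"
    using c v by (simp flip: assoc_mult_mat_vec[of _ n n _ n])
  then have "(mat_adjoint U *\<^sub>v (M *\<^sub>v v)) $ i = row ?D i \<bullet> (mat_adjoint U *\<^sub>v v)"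
    using i by (simp add: mat_diag_def)
  also have "\<dots> = (\<Sum>k<n. (if i = k then complex_of_real (d k) else 0) * (mat_adjoint U *\<^sub>v v) $ k)"
    unfolding scalar_prod_def using i c v by (simp add: mat_diag_def atLeast0LessThan)
  also have "\<dots> = (\<Sum>k<n. if k = i then complex_of_real (d i) * (mat_adjoint U *\<^sub>v v) $ i else 0)"
    by (intro sum.cong) auto
  also have "\<dots> = complex_of_real (d i) * (mat_adjoint U *\<^sub>v v) $ i" using i by simp
  finally show ?thesis .
qed

lemma cscalar_coord:
  assumes U: "U \<in> carrier_mat n n" "unitary_mat U" and v: "v \<in> carrier_vec n" "w \<in> carrier_vec n"
  shows "Re (v \<bullet>c w) = (\<Sum>i<n. Re ((mat_adjoint U *\<^sub>v v) $ i * cnj ((mat_adjoint U *\<^sub>v w) $ i)))"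
proof -
  have "v \<bullet>c w = (\<Sum>i<n. (mat_adjoint U *\<^sub>v v) $ i * cnj ((mat_adjoint U *\<^sub>v w) $ i))"
    unfolding unitary_cscalar[OF U v, symmetric] by (subst cscalar_prod_sum) (use U in simp)
  then show ?thesis by (simp only: Re_sum)
qed

lemma sqnorm_coord:
  assumes U: "U \<in> carrier_mat n n" "unitary_mat U" and v: "v \<in> carrier_vec n"
  shows "sqnorm v = (\<Sum>i<n. (cmod ((mat_adjoint U *\<^sub>v v) $ i))\<^sup>2)"
  using unitary_sqnorm[OF U v] U by (simp add: sqnorm_def)

lemma qform_coord:
  assumes "spectral_decomp n U d M" and v: "v \<in> carrier_vec n"
  shows "qform M v = (\<Sum>i<n. d i * (cmod ((mat_adjoint U *\<^sub>v v) $ i))\<^sup>2)"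
proof -
  note c = spectral_decompD[OF assms(1)]
  have "qform M v = (\<Sum>i<n. Re ((mat_adjoint U *\<^sub>v (M *\<^sub>v v)) $ i * cnj ((mat_adjoint U *\<^sub>v v) $ i)))"
    unfolding qform_def by (rule cscalar_coord) (use c v in auto)
  also have "\<dots> = (\<Sum>i<n. d i * (cmod ((mat_adjoint U *\<^sub>v v) $ i))\<^sup>2)"
  proof (intro sum.cong refl)
    fix i assume i: "i \<in> {..<n}"
    show "Re ((mat_adjoint U *\<^sub>v (M *\<^sub>v v)) $ i * cnj ((mat_adjoint U *\<^sub>v v) $ i)) = d i * (cmod ((mat_adjoint U *\<^sub>v v) $ i))\<^sup>2"
      using i by (simp add: spectral_decomp_coord[OF assms] mult.assoc complex_mult_cnj cmod_power2 del: index_mult_mat_vec)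
  qed
  finally show ?thesis .
qed

lemma eigenvalue_qform:
  assumes "spectral_decomp n U d M" "i < n"
  shows "qform M (col U i) = d i" "sqnorm (col U i) = 1"
proof -
  note c = spectral_decompD[OF assms(1)]
  have co: "(mat_adjoint U *\<^sub>v col U i) $ j = (if j = i then 1 else 0)" if "j < n" for j
  proof -
    have "(mat_adjoint U * U) $$ (j, i) = (mat_adjoint U *\<^sub>v col U i) $ j"
      using that assms c by (simp del: mat_adjoint_index)
    then show ?thesis using unitary_mat_cancel[OF c(1,2)] that assms by simp
  qed
  have v: "col U i \<in> carrier_vec n" using c by (metis carrier_matD(1) col_carrier_vec assms(2) carrier_matD(2))
  have "qform M (col U i) = (\<Sum>j<n. if j = i then d i else 0)"
    unfolding qform_coord[OF assms(1) v] by (intro sum.cong) (auto simp: co simp del: index_mult_mat_vec)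
  then show "qform M (col U i) = d i" using assms by simp
  have "sqnorm (col U i) = (\<Sum>j<n. if j = i then 1 else 0)"
    unfolding sqnorm_coord[OF c(1,2) v] by (intro sum.cong) (auto simp: co simp del: index_mult_mat_vec)
  then show "sqnorm (col U i) = 1" using assms by simp
qed

text \<open>Complete \<open>v\<close> to a basis, apply Gram-Schmidt and normalise.\<close>

lemma unitary_with_first_column:
  fixes v :: "complex vec"
  assumes v: "v \<in> carrier_vec n" and v0: "v \<noteq> 0\<^sub>v n"
  obtains W c where "W \<in> carrier_mat n n" "unitary_mat W" "col W 0 = c \<cdot>\<^sub>v v"
proof -
  have n: "n > 0" using v v0 by (cases n) auto
  interpret cof_vec_space n "TYPE(complex)" .
  define b where "b = basis_completion v"
  define ws where "ws = gram_schmidt n b"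
  note bc = basis_completion[OF v v0, folded b_def]
  then obtain vs where bv: "b = v # vs" using n by (cases b) auto
  note gs = gram_schmidt_result[OF bc(2,4,5) refl, folded ws_def]
  have len: "length ws = n" using gs bc by simp
  have "hd ws = v" using gram_schmidt_hd[OF v, of vs] unfolding ws_def bv .
  then have ws0: "ws ! 0 = v" using len n by (metis hd_conv_nth length_greater_0_conv)
  have wsi: "ws ! i \<in> carrier_vec n" if "i < n" for i using gs(3) len that by auto
  define c where "c i = complex_of_real (1 / sqrt (sqnorm (ws ! i)))" for i
  define W where "W = Matrix.mat n n (\<lambda>(i, j). c j * (ws ! j) $ i)"
  have W: "W \<in> carrier_mat n n" by (simp add: W_def)
  have orth: "(ws ! i \<bullet>c ws ! j = 0) = (i \<noteq> j)" if "i < n" "j < n" for i j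
    using corthogonalD[OF gs(2)] len that by auto
  have "mat_adjoint W * W = 1\<^sub>m n"
  proof (rule eq_matI)
    fix i j assume "i < dim_row (1\<^sub>m n :: complex mat)" "j < dim_col (1\<^sub>m n :: complex mat)"
    then have ij: "i < n" "j < n" by auto
    have "(mat_adjoint W * W) $$ (i, j) = (\<Sum>k<n. cnj (c i * ws ! i $ k) * (c j * ws ! j $ k))"
      using ij W by (simp add: scalar_prod_def atLeast0LessThan) (simp add: W_def)
    also have "\<dots> = cnj (c i) * c j * (ws ! j \<bullet>c ws ! i)"
      using ij carrier_vecD[OF wsi[OF ij(1)]] by (simp add: cscalar_prod_sum sum_distrib_left mult_ac)
    also have "\<dots> = (1\<^sub>m n) $$ (i, j)"
    proof (cases "i = j")
      case True
      have "sqnorm (ws ! i) \<noteq> 0" using orth[OF ij(1) ij(1)] by (simp flip: sqnorm_eq)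
      moreover have "sqnorm (ws ! i) \<ge> 0" by (simp add: sqnorm_def sum_nonneg)
      ultimately have "1 / sqrt (sqnorm (ws ! i)) * (1 / sqrt (sqnorm (ws ! i))) * sqnorm (ws ! i) = 1"
        by simp
      then have "complex_of_real (1 / sqrt (sqnorm (ws ! i)) * (1 / sqrt (sqnorm (ws ! i))) * sqnorm (ws ! i)) = 1"
        by (simp only: of_real_1)
      then have "cnj (c i) * c i * (ws ! i \<bullet>c ws ! i) = 1"
        unfolding c_def sqnorm_eq[symmetric] by (simp only: complex_cnj_complex_of_real of_real_mult)
      then show ?thesis using True ij by simp
    qed (use orth ij in simp)
    finally show "(mat_adjoint W * W) $$ (i, j) = (1\<^sub>m n) $$ (i, j)" .
  qed (use W in auto)
  then have "unitary_mat W" using W by (simp add: unitary_mat_def)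
  moreover have "col W 0 = c 0 \<cdot>\<^sub>v v" using n v by (intro eq_vecI) (auto simp: W_def ws0)
  ultimately show ?thesis using that W by blast
qed

lemma spectral_decomp_iff_index:
  assumes "U \<in> carrier_mat n n" "unitary_mat U" "M \<in> carrier_mat n n"
  shows "spectral_decomp n U d M \<longleftrightarrow>
    (\<forall>i<n. \<forall>j<n. M $$ (i, j) = (\<Sum>k<n. U $$ (i, k) * complex_of_real (d k) * cnj (U $$ (j, k))))"
proof -
  have "(U * mat_diag n (\<lambda>i. complex_of_real (d i)) * mat_adjoint U) $$ (i, j)
      = (\<Sum>k<n. U $$ (i, k) * complex_of_real (d k) * cnj (U $$ (j, k)))" if "i < n" "j < n" for i j
    using that assms by (simp add: mat_diag_mult_right[OF assms(1)] scalar_prod_def atLeast0LessThan)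
  then show ?thesis using assms unfolding spectral_decomp_def mat_eq_iff by auto
qed

lemma unitary_iff_index:
  assumes "U \<in> carrier_mat n n"
  shows "unitary_mat U \<longleftrightarrow> (\<forall>i<n. \<forall>j<n. (\<Sum>k<n. cnj (U $$ (k, i)) * U $$ (k, j)) = (if i = j then 1 else 0))"
proof -
  have "(mat_adjoint U * U) $$ (i, j) = (\<Sum>k<n. cnj (U $$ (k, i)) * U $$ (k, j))" if "i < n" "j < n" for i j
    using that assms by (simp add: scalar_prod_def atLeast0LessThan)
  then show ?thesis using assms unfolding unitary_mat_def mat_eq_iff by auto
qed

lemma unitary_mult:
  assumes U: "U \<in> carrier_mat n n" "unitary_mat U" and V: "V \<in> carrier_mat n n" "unitary_mat V"
  shows "unitary_mat (U * V)"
proof -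
  have a: "mat_adjoint U \<in> carrier_mat n n" "mat_adjoint V \<in> carrier_mat n n"
    using U V mat_adjoint_carrier by auto
  have "mat_adjoint (U * V) * (U * V) = mat_adjoint V * ((mat_adjoint U * U) * V)"
    using U V a by (simp add: mat_adjoint_mult[of _ n n _ n] assoc_mult_mat[of _ n n _ n _ n] mult_carrier_mat[of _ n n])
  then show ?thesis using U V unitary_mat_cancel[OF U] unitary_mat_cancel[OF V]
    by (simp add: unitary_mat_def)
qed

text \<open>
  Induction on the dimension. A unitary \<open>W\<close> whose first column is an eigenvector turns \<open>M\<close> into a matrix
  whose first row and column vanish off the diagonal; the induction hypothesis diagonalises the rest.
\<close>

lemma spectral_theorem:
  assumes "M \<in> carrier_mat n n" "self_adjoint M"
  shows "\<exists>U d. spectral_decomp n U d M"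
  using assms
proof (induction n arbitrary: M)
  case 0
  have "spectral_decomp 0 (1\<^sub>m 0) (\<lambda>_. 0) M"
    using 0 unfolding spectral_decomp_def unitary_mat_def by (auto intro!: eq_matI)
  then show ?case by blast
next
  case (Suc n)
  note M = Suc.prems(1)
  have "\<not> constant (poly (char_poly M))"
    using degree_monic_char_poly[OF M] by (simp add: constant_degree)
  from fundamental_theorem_of_algebra[OF this] obtain e where "poly (char_poly M) e = 0" by blast
  then have "eigenvalue M e" using eigenvalue_root_char_poly[OF M] by simp
  then obtain v where v: "v \<in> carrier_vec (Suc n)" "v \<noteq> 0\<^sub>v (Suc n)" "M *\<^sub>v v = e \<cdot>\<^sub>v v"
    using M unfolding eigenvalue_def eigenvector_def by auto
  obtain W c where W: "W \<in> carrier_mat (Suc n) (Suc n)" "unitary_mat W" and W0: "col W 0 = c \<cdot>\<^sub>v v"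
    using unitary_with_first_column[OF v(1,2)] by blast
  define W' where "W' = mat_adjoint W"
  have W': "W' \<in> carrier_mat (Suc n) (Suc n)" using W mat_adjoint_carrier W'_def by auto
  have inv: "W' * W = 1\<^sub>m (Suc n)" "W * W' = 1\<^sub>m (Suc n)" using unitary_mat_cancel[OF W] W'_def by auto
  note assoc = assoc_mult_mat[of _ "Suc n" "Suc n" _ "Suc n" _ "Suc n"] mult_carrier_mat[of _ "Suc n" "Suc n"]
  define A where "A = W' * M * W"
  have A: "A \<in> carrier_mat (Suc n) (Suc n)" using W W' M by (simp add: A_def)
  have adjM: "mat_adjoint M = M" using Suc.prems by (simp add: self_adjoint_def)
  have "mat_adjoint A = W' * M * W"
    unfolding A_def using W W' M W'_def adjM
    by (simp add: mat_adjoint_mult[of _ "Suc n" "Suc n" _ "Suc n"] assoc)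
  then have "mat_adjoint A = A" by (simp add: A_def)
  then have adjA: "A $$ (i, j) = cnj (A $$ (j, i))" if "i < Suc n" "j < Suc n" for i j
    using that A mat_adjoint_index[of i A j] by (metis carrier_matD)
  have col0: "A $$ (i, 0) = (if i = 0 then e else 0)" if i: "i < Suc n" for i
  proof -
    have vc: "col W 0 \<in> carrier_vec (Suc n)" using W0 v by simp
    have "col A 0 = (W' * M) *\<^sub>v col W 0" unfolding A_def
      using col_mult2[of "W' * M" "Suc n" "Suc n" W "Suc n" 0] W W' M by simp
    also have "\<dots> = W' *\<^sub>v (M *\<^sub>v col W 0)" using W' M vc by simp
    also have "M *\<^sub>v col W 0 = e \<cdot>\<^sub>v col W 0"
      unfolding W0 using v M by (simp add: mult_mat_vec[of _ "Suc n" "Suc n"] smult_smult_assoc mult.commute)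
    also have "W' *\<^sub>v (e \<cdot>\<^sub>v col W 0) = e \<cdot>\<^sub>v (W' *\<^sub>v col W 0)" using W' vc by (simp add: mult_mat_vec)
    also have "W' *\<^sub>v col W 0 = col (W' * W) 0"
      by (rule col_mult2[of W' "Suc n" "Suc n" W "Suc n" 0, symmetric]) (use W W' in auto)
    finally have "col A 0 = e \<cdot>\<^sub>v col (1\<^sub>m (Suc n)) 0" unfolding inv .
    then have "col A 0 $ i = (e \<cdot>\<^sub>v col (1\<^sub>m (Suc n)) 0) $ i" by simp
    then show ?thesis using i A by simp
  qed
  have row0: "A $$ (0, i) = (if i = 0 then e else 0)" if "i < Suc n" for i
    using adjA[of 0 i] adjA[of 0 0] col0[of i] col0[of 0] that by auto
  have e: "complex_of_real (Re e) = e" using adjA[of 0 0] col0[of 0] by (simp add: complex_eq_iff)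
  define M3 where "M3 = Matrix.mat n n (\<lambda>(i, j). A $$ (Suc i, Suc j))"
  have "mat_adjoint M3 = M3" 
    by (rule eq_matI) (auto simp: M3_def intro: adjA[symmetric])
  then have "self_adjoint M3" by (simp add: self_adjoint_def M3_def)
  then obtain U3 d3 where e3: "spectral_decomp n U3 d3 M3" using Suc.IH[of M3] by (auto simp: M3_def)
  note c3 = spectral_decompD[OF e3]
  define U4 where "U4 = Matrix.mat (Suc n) (Suc n) (\<lambda>(i, j). if i = 0 \<or> j = 0 then (if i = j then 1 else 0)
     else U3 $$ (i - 1, j - 1))"
  define d4 where "d4 = case_nat (Re e) d3"
  have U4: "U4 \<in> carrier_mat (Suc n) (Suc n)" by (simp add: U4_def)
  have U4i: "U4 $$ (0, 0) = 1" "i < n \<Longrightarrow> U4 $$ (0, Suc i) = 0" "i < n \<Longrightarrow> U4 $$ (Suc i, 0) = 0"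
     "i < n \<Longrightarrow> j < n \<Longrightarrow> U4 $$ (Suc i, Suc j) = U3 $$ (i, j)" for i j
    by (simp_all add: U4_def)
  have un4: "unitary_mat U4" unfolding unitary_iff_index[OF U4]
  proof (intro allI impI)
    fix i j assume "i < Suc n" "j < Suc n"
    then show "(\<Sum>k<Suc n. cnj (U4 $$ (k, i)) * U4 $$ (k, j)) = (if i = j then 1 else 0)"
      unfolding sum.lessThan_Suc_shift using unitary_iff_index[OF c3(1)] c3(2)
      by (cases i; cases j) (simp_all add: U4i)
  qed
  have e4: "spectral_decomp (Suc n) U4 d4 A" unfolding spectral_decomp_iff_index[OF U4 un4 A]
  proof (intro allI impI)
    fix i j assume ij: "i < Suc n" "j < Suc n"
    have ind: "A $$ (Suc i, Suc j) = (\<Sum>k<n. U3 $$ (i, k) * complex_of_real (d3 k) * cnj (U3 $$ (j, k)))"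
      if "i < n" "j < n" for i j
      using e3[unfolded spectral_decomp_iff_index[OF c3(1,2,4)]] that by (auto simp: M3_def)
    show "A $$ (i, j) = (\<Sum>k<Suc n. U4 $$ (i, k) * complex_of_real (d4 k) * cnj (U4 $$ (j, k)))"
      unfolding sum.lessThan_Suc_shift using ij
      by (cases i; cases j) (simp_all add: U4i d4_def e col0 row0 ind)
  qed
  have "M = W * A * W'"
  proof -
    have "W * A * W' = (W * W') * M * (W * W')" unfolding A_def using W W' M by (simp add: assoc)
    then show ?thesis unfolding inv using M by simp
  qed
  also have "\<dots> = (W * U4) * mat_diag (Suc n) (\<lambda>i. complex_of_real (d4 i)) * mat_adjoint (W * U4)"
  proof -
    let ?D = "mat_diag (Suc n) (\<lambda>i. complex_of_real (d4 i))"
    have D: "?D \<in> carrier_mat (Suc n) (Suc n)" by simp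
    have a4: "mat_adjoint U4 \<in> carrier_mat (Suc n) (Suc n)" using mat_adjoint_carrier[OF U4] .
    have ad: "mat_adjoint (W * U4) = mat_adjoint U4 * W'"
      unfolding W'_def by (rule mat_adjoint_mult[OF W(1) U4])
    have "W * (U4 * ?D * mat_adjoint U4) * W' = (W * U4) * ?D * (mat_adjoint U4 * W')"
      using W(1) W' U4 D a4 by (simp add: assoc)
    then show ?thesis unfolding ad spectral_decompD(5)[OF e4] .
  qed
  finally have "spectral_decomp (Suc n) (W * U4) d4 M"
    unfolding spectral_decomp_def using unitary_mult[OF W U4 un4] W U4 by simp
  then show ?case by blast
qed

lemma spectral_decomp_sorted:
  fixes f :: "real \<Rightarrow> real"
  assumes "spectral_decomp n U d M"
  obtains V e where "spectral_decomp n V e M" "\<And>i j. i \<le> j \<Longrightarrow> j < n \<Longrightarrow> f (e i) \<le> f (e j)"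
proof -
  note c = spectral_decompD[OF assms]
  define xs where "xs = sort_key (\<lambda>i. f (d i)) [0..<n]"
  have xs: "length xs = n" "set xs = {..<n}" "distinct xs" "sorted (map (\<lambda>i. f (d i)) xs)"
    by (auto simp: xs_def)
  then have bij: "bij_betw ((!) xs) {..<n} {..<n}" by (intro bij_betw_nth) simp_all
  have lt: "xs ! i < n" if "i < n" for i by (metis xs(1,2) that nth_mem lessThan_iff)
  define V where "V = Matrix.mat n n (\<lambda>(i, j). U $$ (i, xs ! j))"
  have V: "V \<in> carrier_mat n n" by (simp add: V_def)
  have unV: "unitary_mat V" unfolding unitary_iff_index[OF V]
    using c(2)[unfolded unitary_iff_index[OF c(1)]] xs lt by (simp add: V_def nth_eq_iff_index_eq)
  have "spectral_decomp n V (\<lambda>i. d (xs ! i)) M" unfolding spectral_decomp_iff_index[OF V unV c(4)]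
  proof (intro allI impI)
    fix i j assume ij: "i < n" "j < n"
    have "M $$ (i, j) = (\<Sum>k<n. U $$ (i, k) * complex_of_real (d k) * cnj (U $$ (j, k)))"
      using assms[unfolded spectral_decomp_iff_index[OF c(1,2,4)]] ij by auto
    also have "\<dots> = (\<Sum>k<n. U $$ (i, xs ! k) * complex_of_real (d (xs ! k)) * cnj (U $$ (j, xs ! k)))"
      by (rule sum.reindex_bij_betw[OF bij, symmetric])
    also have "\<dots> = (\<Sum>k<n. V $$ (i, k) * complex_of_real (d (xs ! k)) * cnj (V $$ (j, k)))"
      using ij by (intro sum.cong) (auto simp: V_def)
    finally show "M $$ (i, j) = (\<Sum>k<n. V $$ (i, k) * complex_of_real (d (xs ! k)) * cnj (V $$ (j, k)))" .
  qed
  moreover have "f (d (xs ! i)) \<le> f (d (xs ! j))" if "i \<le> j" "j < n" for i j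
    using sorted_nth_mono[OF xs(4), of i j] that xs(1) by simp
  ultimately show ?thesis using that by blast
qed


section \<open>Resolvents and their order relations\<close>

definition resolvent :: "real \<Rightarrow> complex mat \<Rightarrow> complex mat" where
  "resolvent t M = mat_fun (\<lambda>x. 1 / (t + x)) M"

lemma spectral_decomp_mat_fun:
  assumes "spectral_decomp n U d M" shows "spectral_decomp n U (\<lambda>i. f (d i)) (mat_fun f M)"
  using mat_fun_eq[OF spectral_decompD(1,2,5)[OF assms]] spectral_decompD[OF assms] unfolding spectral_decomp_def by blast

lemma spectral_decomp_resolvent:
  assumes "spectral_decomp n U d M" shows "spectral_decomp n U (\<lambda>i. 1 / (t + d i)) (resolvent t M)"
  unfolding resolvent_def by (rule spectral_decomp_mat_fun[OF assms])

text \<open>The difference of the two sides is \<open>\<bar>\<alpha> - c \<beta>\<bar>\<^sup>2 / c\<close>.\<close>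

lemma complex_young:
  fixes \<alpha> \<beta> :: complex and c :: real
  assumes "c > 0"
  shows "2 * Re (\<alpha> * cnj \<beta>) - c * (cmod \<beta>)\<^sup>2 \<le> (cmod \<alpha>)\<^sup>2 / c"
proof -
  have *: "2 * (a * b) - c * b\<^sup>2 \<le> a\<^sup>2 / c" for a b :: real
  proof -
    have "0 \<le> (a - c * b)\<^sup>2 / c" using assms by simp
    also have "\<dots> = a\<^sup>2 / c - (2 * (a * b) - c * b\<^sup>2)" using assms by (simp add: power2_eq_square field_simps)
    finally show ?thesis by simp
  qed
  show ?thesis using *[of "Re \<alpha>" "Re \<beta>"] *[of "Im \<alpha>" "Im \<beta>"]
    by (simp add: cmod_power2 add_divide_distrib algebra_simps)
qed

lemma Re_mult_cnj_scaled: "Re (\<alpha> * cnj (complex_of_real k * \<alpha>)) = k * (cmod \<alpha>)\<^sup>2"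
  by (simp add: cmod_power2 power2_eq_square[of "Re \<alpha>"] power2_eq_square[of "Im \<alpha>"] algebra_simps)

lemma Re_mult_cnj_divide: "Re (\<alpha> * cnj (\<alpha> / complex_of_real k)) = (cmod \<alpha>)\<^sup>2 / k"
  using Re_mult_cnj_scaled[of \<alpha> "1 / k"] by simp

text \<open>
  With \<open>resolvent_attains\<close>: \<open>\<langle>u, (t + X)\<^sup>-\<^sup>1 u\<rangle>\<close> is the maximum over \<open>z\<close> of
  \<open>2 Re \<langle>u, z\<rangle> - \<langle>z, (t + X) z\<rangle>\<close>, attained at \<open>z = (t + X)\<^sup>-\<^sup>1 u\<close>. In this form an upper bound for \<open>X\<close> gives
  a lower bound for its resolvent.
\<close>

lemma resolvent_variational:
  assumes X: "spectral_decomp n Q x X" and x: "\<And>i. i < n \<Longrightarrow> x i \<ge> 0" and t: "t > 0"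
    and u: "u \<in> carrier_vec n" and z: "z \<in> carrier_vec n"
  shows "2 * Re (u \<bullet>c z) - qform X z - t * sqnorm z \<le> qform (resolvent t X) u"
proof -
  note c = spectral_decompD[OF X]
  let ?u = "\<lambda>i. (mat_adjoint Q *\<^sub>v u) $ i" and ?z = "\<lambda>i. (mat_adjoint Q *\<^sub>v z) $ i"
  have "2 * Re (u \<bullet>c z) - qform X z - t * sqnorm z
      = (\<Sum>i<n. 2 * Re (?u i * cnj (?z i)) - (t + x i) * (cmod (?z i))\<^sup>2)"
    unfolding cscalar_coord[OF c(1,2) u z] qform_coord[OF X z] sqnorm_coord[OF c(1,2) z]
    by (simp only: sum_distrib_left sum_subtractf[symmetric] distrib_right diff_diff_eq add.commute)
  also have "\<dots> \<le> (\<Sum>i<n. 1 / (t + x i) * (cmod (?u i))\<^sup>2)"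
  proof (intro sum_mono)
    fix i assume "i \<in> {..<n}"
    then have "t + x i > 0" using x[of i] t by simp
    from complex_young[OF this, of "?u i" "?z i"]
    show "2 * Re (?u i * cnj (?z i)) - (t + x i) * (cmod (?z i))\<^sup>2 \<le> 1 / (t + x i) * (cmod (?u i))\<^sup>2"
      by (simp only: mult_1_left times_divide_eq_left)
  qed
  also have "\<dots> = qform (resolvent t X) u"
    unfolding qform_coord[OF spectral_decomp_resolvent[OF X] u] ..
  finally show ?thesis .
qed

lemma resolvent_attains:
  assumes X: "spectral_decomp n Q x X" and x: "\<And>i. i < n \<Longrightarrow> x i \<ge> 0" and t: "t > 0"
    and u: "u \<in> carrier_vec n"
  defines "z \<equiv> resolvent t X *\<^sub>v u"
  shows "Re (u \<bullet>c z) = qform (resolvent t X) u" "Re (u \<bullet>c z) = qform X z + t * sqnorm z"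
proof -
  note c = spectral_decompD[OF X] and R = spectral_decompD[OF spectral_decomp_resolvent[OF X]]
  have z: "z \<in> carrier_vec n" unfolding z_def by (rule mult_mat_vec_carrier[OF R(4) u])
  let ?u = "\<lambda>i. (mat_adjoint Q *\<^sub>v u) $ i" and ?z = "\<lambda>i. (mat_adjoint Q *\<^sub>v z) $ i"
  have co: "?z i = complex_of_real (1 / (t + x i)) * ?u i" if "i < n" for i
    unfolding z_def by (rule spectral_decomp_coord[OF spectral_decomp_resolvent[OF X] u that])
  have pos: "t + x i > 0" if "i < n" for i using x[OF that] t by simp
  have 1: "Re (?u i * cnj (?z i)) = 1 / (t + x i) * (cmod (?u i))\<^sup>2" if "i < n" for i
    unfolding co[OF that] by (rule Re_mult_cnj_scaled)
  have 2: "Re (?u i * cnj (?z i)) = x i * (cmod (?z i))\<^sup>2 + t * (cmod (?z i))\<^sup>2" if "i < n" for i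
  proof -
    have "x i * (cmod (?z i))\<^sup>2 + t * (cmod (?z i))\<^sup>2 = (t + x i) * ((1 / (t + x i))\<^sup>2 * (cmod (?u i))\<^sup>2)"
      unfolding co[OF that] norm_mult norm_of_real power_mult_distrib power2_abs by (simp add: distrib_right)
    also have "\<dots> = 1 / (t + x i) * (cmod (?u i))\<^sup>2" using pos[OF that] by (simp add: power2_eq_square)
    finally show ?thesis unfolding 1[OF that] by simp
  qed
  show "Re (u \<bullet>c z) = qform (resolvent t X) u"
    unfolding cscalar_coord[OF c(1,2) u z] qform_coord[OF spectral_decomp_resolvent[OF X] u]
    using 1 by (intro sum.cong) auto
  show "Re (u \<bullet>c z) = qform X z + t * sqnorm z"
    unfolding cscalar_coord[OF c(1,2) u z] qform_coord[OF X z] sqnorm_coord[OF c(1,2) z]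
      sum_distrib_left sum.distrib[symmetric]
    using 2 by (intro sum.cong) auto
qed

text \<open>
  This is \<open>(t + X)\<^sup>-\<^sup>1 \<ge> (t + A + s)\<^sup>-\<^sup>1\<close> whenever \<open>X \<le> A + s\<close>, with the right-hand side written in the
  eigenbasis of \<open>A\<close>. Insert \<open>z = (t + A + s)\<^sup>-\<^sup>1 u\<close> into the variational formula.
\<close>

lemma resolvent_lower_bound:
  assumes X: "spectral_decomp n Q x X" and x: "\<And>i. i < n \<Longrightarrow> x i \<ge> 0" and t: "t > 0"
    and A: "spectral_decomp n U a A" and pos: "\<And>i. i < n \<Longrightarrow> t + a i + s > 0"
    and le: "\<And>v. v \<in> carrier_vec n \<Longrightarrow> qform X v \<le> qform A v + s * sqnorm v"
    and u: "u \<in> carrier_vec n"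
  shows "(\<Sum>i<n. (cmod ((mat_adjoint U *\<^sub>v u) $ i))\<^sup>2 / (t + a i + s)) \<le> qform (resolvent t X) u"
proof -
  note c = spectral_decompD[OF A]
  let ?u = "\<lambda>i. (mat_adjoint U *\<^sub>v u) $ i"
  define y where "y = Matrix.vec n (\<lambda>i. ?u i / complex_of_real (t + a i + s))"
  define z where "z = U *\<^sub>v y"
  have y: "y \<in> carrier_vec n" by (simp add: y_def)
  have z: "z \<in> carrier_vec n" using c y by (simp add: z_def)
  have zy: "mat_adjoint U *\<^sub>v z = y"
    unfolding z_def using c y unitary_mat_cancel[OF c(1,2)] by (simp flip: assoc_mult_mat_vec[of _ n n _ n])
  have yi: "y $ i = ?u i / complex_of_real (t + a i + s)" if "i < n" for i
    using that by (simp add: y_def del: index_mult_mat_vec)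
  have "(\<Sum>i<n. (cmod (?u i))\<^sup>2 / (t + a i + s))
     = (\<Sum>i<n. 2 * Re (?u i * cnj (y $ i)) - a i * (cmod (y $ i))\<^sup>2 - (s + t) * (cmod (y $ i))\<^sup>2)"
  proof (intro sum.cong refl)
    fix i assume "i \<in> {..<n}"
    then have i: "i < n" by simp
    define k where "k = t + a i + s"
    have k: "k > 0" using pos[OF i] by (simp add: k_def)
    have 1: "Re (?u i * cnj (y $ i)) = (cmod (?u i))\<^sup>2 / k"
      unfolding yi[OF i] k_def[symmetric]
      by (rule Re_mult_cnj_divide)
    have 2: "(cmod (y $ i))\<^sup>2 = (cmod (?u i))\<^sup>2 / k\<^sup>2"
      unfolding yi[OF i] k_def[symmetric] norm_divide norm_of_real power_divide power2_abs ..
    have 3: "a i * m + (s + t) * m = k * m" for m by (simp add: k_def algebra_simps)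
    have "2 * Re (?u i * cnj (y $ i)) - a i * (cmod (y $ i))\<^sup>2 - (s + t) * (cmod (y $ i))\<^sup>2
        = 2 * Re (?u i * cnj (y $ i)) - k * (cmod (y $ i))\<^sup>2"
      using 3[of "(cmod (y $ i))\<^sup>2"] by linarith
    also have "\<dots> = (cmod (?u i))\<^sup>2 / k"
      unfolding 1 2 using k by (simp add: power2_eq_square del: index_mult_mat_vec)
    finally show "(cmod (?u i))\<^sup>2 / (t + a i + s) = 2 * Re (?u i * cnj (y $ i)) - a i * (cmod (y $ i))\<^sup>2 - (s + t) * (cmod (y $ i))\<^sup>2"
      by (simp only: k_def)
  qed
  also have "\<dots> = 2 * Re (u \<bullet>c z) - qform A z - (s + t) * sqnorm z"
    unfolding cscalar_coord[OF c(1,2) u z] qform_coord[OF A z] sqnorm_coord[OF c(1,2) z] zy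
    by (simp only: sum_distrib_left sum_subtractf)
  also have "\<dots> \<le> 2 * Re (u \<bullet>c z) - qform X z - t * sqnorm z"
    using le[OF z] by (simp add: algebra_simps)
  also have "\<dots> \<le> qform (resolvent t X) u" by (rule resolvent_variational[OF X x t u z])
  finally show ?thesis .
qed

lemma resolvent_antimono:
  assumes X: "spectral_decomp n Q x X" "\<And>i. i < n \<Longrightarrow> x i \<ge> 0" and Y: "spectral_decomp n P y Y" "\<And>i. i < n \<Longrightarrow> y i \<ge> 0" and t: "t > 0"
    and le: "\<And>v. v \<in> carrier_vec n \<Longrightarrow> qform X v \<le> qform Y v"
    and u: "u \<in> carrier_vec n"
  shows "qform (resolvent t Y) u \<le> qform (resolvent t X) u"
proof -
  have "(\<Sum>i<n. (cmod ((mat_adjoint P *\<^sub>v u) $ i))\<^sup>2 / (t + y i + 0)) \<le> qform (resolvent t X) u"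
    using Y t le by (intro resolvent_lower_bound[OF X t Y(1) _ _ u]) (auto simp: add_pos_nonneg)
  then show ?thesis unfolding qform_coord[OF spectral_decomp_resolvent[OF Y(1)] u] by simp
qed

text \<open>
  There are \<open>j\<close> homogeneous equations for the \<open>j + 1\<close> unknowns \<open>c\<^sub>0, \<dots>, c\<^sub>j\<close>. Adding a zero row gives a
  singular square matrix.
\<close>

lemma underdetermined_system:
  fixes K :: "nat \<Rightarrow> nat \<Rightarrow> complex"
  assumes "j < n"
  obtains c where "c \<in> carrier_vec n" "c \<noteq> 0\<^sub>v n" "\<And>k. j < k \<Longrightarrow> k < n \<Longrightarrow> c $ k = 0"
    "\<And>i. i < j \<Longrightarrow> (\<Sum>k<n. K i k * c $ k) = 0"
proof -
  define N where "N = Matrix.mat (Suc j) (Suc j) (\<lambda>(i, k). if i < j then K i k else 0)"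
  have N: "N \<in> carrier_mat (Suc j) (Suc j)" by (simp add: N_def)
  have "N\<^sup>T *\<^sub>v unit_vec (Suc j) j = 0\<^sub>v (Suc j)"
  proof (intro eq_vecI)
    fix i assume "i < dim_vec (0\<^sub>v (Suc j) :: complex vec)"
    then show "(N\<^sup>T *\<^sub>v unit_vec (Suc j) j) $ i = (0\<^sub>v (Suc j) :: complex vec) $ i"
      by (simp add: N_def scalar_prod_right_unit)
  qed (simp add: N_def)
  moreover have "unit_vec (Suc j) j \<noteq> (0\<^sub>v (Suc j) :: complex vec)"
    by (metis index_unit_vec(1) index_zero_vec(1) lessI zero_neq_one)
  ultimately have "det N\<^sup>T = 0"
    using det_0_iff_vec_prod_zero_field[of "N\<^sup>T" "Suc j"] N unit_vec_carrier transpose_carrier_mat by blast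
  then have "det N = 0" using det_transpose[OF N] by simp
  then obtain v where v: "v \<in> carrier_vec (Suc j)" "v \<noteq> 0\<^sub>v (Suc j)" "N *\<^sub>v v = 0\<^sub>v (Suc j)"
    using det_0_iff_vec_prod_zero_field[OF N] by blast
  define c where "c = Matrix.vec n (\<lambda>k. if k \<le> j then v $ k else 0)"
  have ck: "c $ k = (if k \<le> j then v $ k else 0)" if "k < n" for k using that by (simp add: c_def)
  from v obtain k where k: "k < Suc j" "v $ k \<noteq> 0" by (auto simp: vec_eq_iff)
  then have "c $ k \<noteq> 0" "k < n" using ck[of k] assms by auto
  then have "c \<noteq> 0\<^sub>v n" by auto
  moreover have "(\<Sum>k<n. K i k * c $ k) = 0" if i: "i < j" for i
  proof -
    have "(\<Sum>k<n. K i k * c $ k) = (\<Sum>k<Suc j. K i k * v $ k)"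
      using assms by (intro sum.mono_neutral_cong_right) (auto simp: ck)
    also have "\<dots> = (N *\<^sub>v v) $ i" using i v(1) N by (simp add: N_def scalar_prod_def atLeast0LessThan del: sum.lessThan_Suc)
    also have "\<dots> = 0" unfolding v(3) using i by simp
    finally show ?thesis .
  qed
  moreover have "c \<in> carrier_vec n" by (simp add: c_def)
  ultimately show ?thesis using that[of c] ck by auto
qed

text \<open>
  By the min-max principle, \<open>l\<^sub>j\<close> is bounded by the maximum of the form of \<open>W = R(Y) - R(X)\<close> on any
  subspace of codimension at most \<open>j\<close> (indices start at \<open>0\<close>). The subspace is cut out by one linear condition
  for each \<open>i < j\<close>, formulated for \<open>u\<close> and \<open>z = R(Y) u\<close> in the eigenbasis of \<open>A\<close>.

  Put \<open>\<tau>\<^sub>i = t + a\<^sub>i - s\<close>, so that \<open>t + A - s\<close> has eigenvalues \<open>\<tau>\<^sub>i\<close>, possibly negative for \<open>i < j\<close>. Where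
  \<open>\<tau>\<^sub>i > 0\<close> the condition is \<open>u\<^sub>i = 0\<close>; where \<open>\<tau>\<^sub>i \<le> 0\<close> it is \<open>u\<^sub>i = \<tau>\<^sub>i z\<^sub>i\<close>, that is,
  \<open>((Y - A + s) z)\<^sub>i = 0\<close>. Under these conditions \<open>\<langle>u, R(Y) u\<rangle> \<le> \<Sum>i\<ge>j. \<bar>u\<^sub>i\<bar>\<^sup>2 / \<tau>\<^sub>i\<close>, as if \<open>Y \<ge> A - s\<close> could be
  inverted and only the coordinates from \<open>j\<close> on counted. Together with \<open>R(X) \<ge> (t + A + s)\<^sup>-\<^sup>1\<close> and the
  monotonicity of \<open>1/(t + a - s) - 1/(t + a + s)\<close> in \<open>a\<close> this gives the bound.
\<close>

lemma resolvent_difference_eigenvalue_bound: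
  assumes A: "spectral_decomp n U a A" and mono: "\<And>i j. i \<le> j \<Longrightarrow> j < n \<Longrightarrow> a i \<le> a j" and a: "\<And>i. i < n \<Longrightarrow> a i \<ge> 0"
    and s: "s \<ge> 0" and t: "t > 0"
    and Y: "spectral_decomp n P y Y" "\<And>i. i < n \<Longrightarrow> y i \<ge> 0" and X: "spectral_decomp n Q x X" "\<And>i. i < n \<Longrightarrow> x i \<ge> 0"
    and YA: "\<And>v. v \<in> carrier_vec n \<Longrightarrow> qform A v - s * sqnorm v \<le> qform Y v"
    and XA: "\<And>v. v \<in> carrier_vec n \<Longrightarrow> qform X v \<le> qform A v + s * sqnorm v"
    and F: "spectral_decomp n F l (resolvent t Y - resolvent t X)"
    and l: "\<And>i j. i \<le> j \<Longrightarrow> j < n \<Longrightarrow> l j \<le> l i"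
    and j: "j < n" and aj: "a j \<ge> s"
  shows "l j \<le> 1 / (t + (a j - s)) - 1 / (t + (a j + s))"
proof -
  note cA = spectral_decompD[OF A] and cF = spectral_decompD[OF F]
    and RY = spectral_decompD[OF spectral_decomp_resolvent[OF Y(1), of t]] and RX = spectral_decompD[OF spectral_decomp_resolvent[OF X(1), of t]]
  define U' where "U' = mat_adjoint U"
  have U': "U' \<in> carrier_mat n n" using cA U'_def by simp
  define \<tau> where "\<tau> i = t + a i - s" for i
  \<comment> \<open>Both kinds of conditions read \<open>u i = \<kappa> i * z i\<close>.\<close>
  define \<kappa> where "\<kappa> i = min 0 (\<tau> i)" for i
  obtain c where c: "c \<in> carrier_vec n" "c \<noteq> 0\<^sub>v n" "\<And>k. j < k \<Longrightarrow> k < n \<Longrightarrow> c $ k = 0"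
    and cons: "\<And>i. i < j \<Longrightarrow> (\<Sum>k<n. ((U' * F) $$ (i, k) - complex_of_real (\<kappa> i) * (U' * resolvent t Y * F) $$ (i, k)) * c $ k) = 0"
    using underdetermined_system[OF j, of "\<lambda>i k. (U' * F) $$ (i, k) - complex_of_real (\<kappa> i) * (U' * resolvent t Y * F) $$ (i, k)"]
    by blast
  define u where "u = F *\<^sub>v c"
  define z where "z = resolvent t Y *\<^sub>v u"
  have u: "u \<in> carrier_vec n" using cF c by (simp add: u_def)
  have z: "z \<in> carrier_vec n" unfolding z_def by (rule mult_mat_vec_carrier[OF RY(4) u])
  have uc: "mat_adjoint F *\<^sub>v u = c"
    unfolding u_def using cF c unitary_mat_cancel[OF cF(1,2)] by (simp flip: assoc_mult_mat_vec[of _ n n _ n])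
  define ui where "ui i = (U' *\<^sub>v u) $ i" for i
  define zi where "zi i = (U' *\<^sub>v z) $ i" for i
  have rel: "ui i = complex_of_real (\<kappa> i) * zi i" if i: "i < j" for i
  proof -
    have G: "(M *\<^sub>v c) $ i = (\<Sum>k<n. M $$ (i, k) * c $ k)" if "M \<in> carrier_mat n n" for M
      using that i j c by (simp add: scalar_prod_def atLeast0LessThan)
    have "ui i = ((U' * F) *\<^sub>v c) $ i" unfolding ui_def u_def using U' cF c by (simp only: assoc_mult_mat_vec)
    moreover have "zi i = ((U' * resolvent t Y * F) *\<^sub>v c) $ i" unfolding zi_def z_def u_def using U' cF c RY
      by (simp only: assoc_mult_mat_vec[of _ n n _ n] mult_carrier_mat[of _ n n] mult_mat_vec_carrier[of _ n n])
    ultimately have "ui i - complex_of_real (\<kappa> i) * zi i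
      = (\<Sum>k<n. ((U' * F) $$ (i, k) - complex_of_real (\<kappa> i) * (U' * resolvent t Y * F) $$ (i, k)) * c $ k)"
      using U' cF RY G[of "U' * F"] G[of "U' * resolvent t Y * F"]
      by (simp only: mult_carrier_mat[of _ n n] left_diff_distrib sum_subtractf sum_distrib_left mult.assoc)
    then show ?thesis using cons[OF i] by simp
  qed
  have "\<tau> i > 0" if "j \<le> i" "i < n" for i using mono[OF that] aj t by (simp add: \<tau>_def)
  note \<tau>pos = this
  have zu: "Re (u \<bullet>c z) = (\<Sum>i<n. Re (ui i * cnj (zi i)))"
    unfolding cscalar_coord[OF cA(1,2) u z] ui_def zi_def U'_def ..
  have att: "Re (u \<bullet>c z) = qform (resolvent t Y) u" "Re (u \<bullet>c z) = qform Y z + t * sqnorm z"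
    using resolvent_attains[OF Y t u] by (simp_all add: z_def)
  \<comment> \<open>The sum below is \<open>\<langle>z, (Y - A + s) z\<rangle>\<close>, because \<open>u = (t + Y) z\<close>.\<close>
  have "0 \<le> qform Y z - (qform A z - s * sqnorm z)" using YA[OF z] by simp
  also have "\<dots> = Re (u \<bullet>c z) - (qform A z + (t - s) * sqnorm z)" using att by (simp add: left_diff_distrib)
  also have "\<dots> = (\<Sum>i<n. Re (ui i * cnj (zi i)) - \<tau> i * (cmod (zi i))\<^sup>2)"
    unfolding zu qform_coord[OF A z] sqnorm_coord[OF cA(1,2) z] U'_def[symmetric] zi_def[symmetric]
      sum_distrib_left sum_subtractf sum.distrib[symmetric]
    by (simp add: \<tau>_def algebra_simps)
  finally have D: "0 \<le> (\<Sum>i<n. Re (ui i * cnj (zi i)) - \<tau> i * (cmod (zi i))\<^sup>2)" .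
  define g where "g i = (if i < j then 0 else (cmod (ui i))\<^sup>2 / \<tau> i)" for i
  \<comment> \<open>Add \<open>\<langle>z, (Y - A + s) z\<rangle> \<ge> 0\<close> to \<open>\<langle>u, R(Y) u\<rangle>\<close> and estimate each coordinate separately: for \<open>i \<ge> j\<close> by completing the square, for \<open>i < j\<close> because \<open>2 \<kappa> - \<tau> = - \<bar>\<tau>\<bar>\<close>.\<close>
  have coord: "Re (ui i * cnj (zi i)) + (Re (ui i * cnj (zi i)) - \<tau> i * (cmod (zi i))\<^sup>2) \<le> g i" if "i < n" for i
  proof (cases "i < j")
    case True
    have "Re (ui i * cnj (zi i)) = \<kappa> i * (cmod (zi i))\<^sup>2"
      unfolding rel[OF True] using Re_mult_cnj_scaled[of "zi i" "\<kappa> i"] by (simp add: algebra_simps)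
    moreover have "(2 * \<kappa> i - \<tau> i) * (cmod (zi i))\<^sup>2 \<le> 0"
      by (intro mult_nonpos_nonneg) (auto simp: \<kappa>_def)
    ultimately show ?thesis using True by (simp add: g_def algebra_simps)
  next
    case False
    then show ?thesis using complex_young[OF \<tau>pos[of i], of "ui i" "zi i"] that by (simp add: g_def)
  qed
  have "qform (resolvent t Y) u \<le> (\<Sum>i<n. Re (ui i * cnj (zi i))) + (\<Sum>i<n. Re (ui i * cnj (zi i)) - \<tau> i * (cmod (zi i))\<^sup>2)"
    using D att zu by linarith
  also have "\<dots> \<le> (\<Sum>i<n. g i)" unfolding sum.distrib[symmetric] using coord by (intro sum_mono) auto
  finally have upY: "qform (resolvent t Y) u \<le> (\<Sum>i<n. g i)" .
  have "(\<Sum>i<n. (cmod (ui i))\<^sup>2 / (t + a i + s)) \<le> qform (resolvent t X) u"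
    unfolding ui_def U'_def using a s t
    by (intro resolvent_lower_bound[OF X t A _ XA u]) (auto simp: add_pos_nonneg)
  with upY have "qform (resolvent t Y) u - qform (resolvent t X) u \<le> (\<Sum>i<n. g i - (cmod (ui i))\<^sup>2 / (t + a i + s))"
    by (simp add: sum_subtractf)
  also have "\<dots> \<le> (\<Sum>i<n. (1 / \<tau> j - 1 / (t + a j + s)) * (cmod (ui i))\<^sup>2)"
  proof (intro sum_mono)
    fix i assume "i \<in> {..<n}"
    then have i: "i < n" by simp
    have hd: "1 / \<tau> m - 1 / (t + a m + s) = 2 * s / (\<tau> m * (t + a m + s))" if "j \<le> m" "m < n" for m
      using \<tau>pos[OF that] a[OF that(2)] s t by (simp add: \<tau>_def field_simps)
    have h0: "1 / \<tau> j - 1 / (t + a j + s) \<ge> 0"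
      unfolding hd[OF order.refl j] using \<tau>pos[OF order.refl j] a[OF j] s t by simp
    have p: "t + a i + s > 0" using a[OF i] s t by simp
    show "g i - (cmod (ui i))\<^sup>2 / (t + a i + s) \<le> (1 / \<tau> j - 1 / (t + a j + s)) * (cmod (ui i))\<^sup>2"
    proof (cases "i < j")
      case True
      have "0 \<le> (cmod (ui i))\<^sup>2 / (t + a i + s)" "0 \<le> (1 / \<tau> j - 1 / (t + a j + s)) * (cmod (ui i))\<^sup>2"
        using h0 p by simp_all
      then show ?thesis using True by (simp add: g_def)
    next
      case False
      then have ji: "j \<le> i" by simp
      have "1 / \<tau> i - 1 / (t + a i + s) \<le> 1 / \<tau> j - 1 / (t + a j + s)"
        unfolding hd[OF ji i] hd[OF order.refl j] using \<tau>pos[OF order.refl j] a[OF j] s t mono[OF ji i]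
        by (intro divide_left_mono mult_mono mult_pos_pos) (auto simp: \<tau>_def)
      from mult_right_mono[OF this, of "(cmod (ui i))\<^sup>2"] show ?thesis
        using False by (simp add: g_def left_diff_distrib)
    qed
  qed
  also have "\<dots> = (1 / \<tau> j - 1 / (t + a j + s)) * sqnorm u"
    unfolding sqnorm_coord[OF cA(1,2) u] ui_def U'_def sum_distrib_left ..
  finally have up: "qform (resolvent t Y - resolvent t X) u \<le> (1 / \<tau> j - 1 / (t + a j + s)) * sqnorm u"
    using qform_minus[OF RY(4) RX(4) u] by simp
  \<comment> \<open>The vector \<open>u\<close> lies in the span of the eigenvectors for \<open>l 0, \<dots>, l j\<close>, all at least \<open>l j\<close>.\<close>
  have "l j * sqnorm u = (\<Sum>k<n. l j * (cmod (c $ k))\<^sup>2)"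
    unfolding sqnorm_coord[OF cF(1,2) u] uc sum_distrib_left ..
  also have "\<dots> \<le> (\<Sum>k<n. l k * (cmod (c $ k))\<^sup>2)"
  proof (intro sum_mono)
    fix k assume "k \<in> {..<n}"
    then show "l j * (cmod (c $ k))\<^sup>2 \<le> l k * (cmod (c $ k))\<^sup>2"
      using l[of k j] j c(3)[of k] by (cases "k \<le> j") (auto intro: mult_right_mono)
  qed
  also have "\<dots> = qform (resolvent t Y - resolvent t X) u" unfolding qform_coord[OF F u] uc ..
  also note up
  finally have fin: "l j * sqnorm u \<le> (1 / \<tau> j - 1 / (t + a j + s)) * sqnorm u" .
  have "u \<noteq> 0\<^sub>v n"
  proof
    assume "u = 0\<^sub>v n"
    then have "c = mat_adjoint F *\<^sub>v 0\<^sub>v n" using uc by simp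
    also have "\<dots> = 0\<^sub>v n" using cF(3) by (intro eq_vecI) (auto simp: scalar_prod_def)
    finally show False using c by simp
  qed
  then have "sqnorm u > 0" using sqnorm_pos u by blast
  with fin show ?thesis by (simp add: \<tau>_def add.assoc add_diff_eq)
qed

text \<open>
  Here \<open>R(Y) - R(X) \<le> R(Y) - R(Y + 2s)\<close>, which is a function of \<open>Y \<ge> 0\<close> alone, namely
  \<open>1/(t + y) - 1/(t + y + 2s)\<close>; this is largest at \<open>y = 0\<close>.
\<close>

lemma resolvent_difference_eigenvalue_cap:
  assumes s: "s \<ge> 0" and t: "t > 0"
    and Y: "spectral_decomp n P y Y" "\<And>i. i < n \<Longrightarrow> y i \<ge> 0" and X: "spectral_decomp n Q x X" "\<And>i. i < n \<Longrightarrow> x i \<ge> 0"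
    and XY: "\<And>v. v \<in> carrier_vec n \<Longrightarrow> qform X v \<le> qform Y v + 2 * s * sqnorm v"
    and F: "spectral_decomp n F l (resolvent t Y - resolvent t X)" and j: "j < n"
  shows "l j \<le> 1 / t - 1 / (t + 2 * s)"
proof -
  note cP = spectral_decompD[OF Y(1)] and cF = spectral_decompD[OF F]
    and RY = spectral_decompD[OF spectral_decomp_resolvent[OF Y(1), of t]] and RX = spectral_decompD[OF spectral_decomp_resolvent[OF X(1), of t]]
  define u where "u = col F j"
  have u: "u \<in> carrier_vec n" unfolding u_def using cF j by auto
  let ?u = "\<lambda>i. (cmod ((mat_adjoint P *\<^sub>v u) $ i))\<^sup>2"
  have "l j = qform (resolvent t Y) u - qform (resolvent t X) u"
    using eigenvalue_qform(1)[OF F j] qform_minus[OF RY(4) RX(4) u] by (simp add: u_def)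
  also have "\<dots> \<le> (\<Sum>i<n. 1 / (t + y i) * ?u i) - (\<Sum>i<n. ?u i / (t + y i + 2 * s))"
    unfolding qform_coord[OF spectral_decomp_resolvent[OF Y(1)] u]
    using Y(2) s t by (intro diff_left_mono resolvent_lower_bound[OF X t Y(1) _ XY u]) (auto simp: add_pos_nonneg)
  also have "\<dots> \<le> (\<Sum>i<n. (1 / t - 1 / (t + 2 * s)) * ?u i)"
    unfolding sum_subtractf[symmetric]
  proof (intro sum_mono)
    fix i assume "i \<in> {..<n}"
    then have yi: "y i \<ge> 0" using Y(2) by simp
    have "1 / (t + y i) - 1 / (t + y i + 2 * s) = 2 * s / ((t + y i) * (t + y i + 2 * s))"
      using yi s t by (simp add: field_simps)
    also have "\<dots> \<le> 2 * s / (t * (t + 2 * s))"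
      using yi s t by (intro divide_left_mono mult_mono mult_pos_pos) auto
    also have "\<dots> = 1 / t - 1 / (t + 2 * s)" using s t by (simp add: field_simps)
    finally have "1 / (t + y i) - 1 / (t + y i + 2 * s) \<le> 1 / t - 1 / (t + 2 * s)" .
    from mult_right_mono[OF this, of "?u i"]
    show "1 / (t + y i) * ?u i - ?u i / (t + y i + 2 * s) \<le> (1 / t - 1 / (t + 2 * s)) * ?u i"
      by (simp add: left_diff_distrib del: index_mult_mat_vec)
  qed
  also have "\<dots> = (1 / t - 1 / (t + 2 * s)) * sqnorm u"
    unfolding sqnorm_coord[OF cP(1,2) u] sum_distrib_left ..
  finally show ?thesis using eigenvalue_qform(2)[OF F j] by (simp add: u_def)
qed


section \<open>Weighted traces in a second orthonormal basis\<close>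

text \<open>
  The squared moduli \<open>\<bar>\<langle>u\<^sub>i, v\<^sub>k\<rangle>\<bar>\<^sup>2\<close> of the inner products of the columns of two unitary matrices. They form a
  doubly stochastic matrix, which makes traces of products accessible to scalar inequalities.
\<close>

definition overlap :: "complex mat \<Rightarrow> complex mat \<Rightarrow> nat \<Rightarrow> nat \<Rightarrow> real" where
  "overlap U V i k = (cmod ((mat_adjoint U *\<^sub>v col V k) $ i))\<^sup>2"

lemma overlap_nonneg [simp]: "overlap U V i k \<ge> 0" by (simp add: overlap_def)

lemma overlap_commute:
  assumes "U \<in> carrier_mat n n" "V \<in> carrier_mat n n" "i < n" "k < n"
  shows "overlap U V i k = overlap V U k i"
proof -
  have "(mat_adjoint U *\<^sub>v col V k) $ i = cnj ((mat_adjoint V *\<^sub>v col U i) $ k)"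
    using assms by (simp add: scalar_prod_def mult.commute)
  then show ?thesis unfolding overlap_def by (simp only: complex_mod_cnj)
qed

lemma overlap_sum_left:
  assumes "U \<in> carrier_mat n n" "unitary_mat U" "V \<in> carrier_mat n n" "unitary_mat V" "k < n"
  shows "(\<Sum>i<n. overlap U V i k) = 1"
proof -
  have v: "col V k \<in> carrier_vec n" using assms by auto
  have "spectral_decomp n V (\<lambda>_. 0) (V * mat_diag n (\<lambda>i. complex_of_real 0) * mat_adjoint V)"
    unfolding spectral_decomp_def using assms by blast
  from eigenvalue_qform(2)[OF this assms(5)] show ?thesis
    unfolding sqnorm_coord[OF assms(1,2) v] overlap_def .
qed

lemma overlap_sum_right:
  assumes "U \<in> carrier_mat n n" "unitary_mat U" "V \<in> carrier_mat n n" "unitary_mat V" "i < n"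
  shows "(\<Sum>k<n. overlap U V i k) = 1"
  using overlap_sum_left[OF assms(3,4,1,2,5)] overlap_commute[OF assms(1,3,5)] by simp

lemma qform_col:
  assumes "spectral_decomp n U d M" "V \<in> carrier_mat n n" "k < n"
  shows "qform M (col V k) = (\<Sum>i<n. d i * overlap U V i k)"
  using qform_coord[OF assms(1), of "col V k"] assms(2,3) unfolding overlap_def by auto

lemma weighted_trace_le:
  assumes F: "spectral_decomp n F l W" and l: "\<And>i j. i \<le> j \<Longrightarrow> j < n \<Longrightarrow> l j \<le> l i"
    and V: "V \<in> carrier_mat n n" "unitary_mat V"
    and w: "\<And>i j. i \<le> j \<Longrightarrow> j < n \<Longrightarrow> w j \<le> w i"
  shows "(\<Sum>k<n. w k * qform W (col V k)) \<le> (\<Sum>k<n. w k * l k)"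
proof -
  note c = spectral_decompD[OF F]
  have "(\<Sum>k<n. w k * qform W (col V k)) = (\<Sum>k<n. \<Sum>j<n. w k * l j * overlap F V j k)"
    using qform_col[OF F V(1)] by (simp add: sum_distrib_left mult.assoc)
  also have "\<dots> \<le> (\<Sum>k<n. w k * l k)"
    using overlap_sum_left[OF c(1,2) V] overlap_sum_right[OF c(1,2) V]
    by (intro doubly_stochastic_rearrangement w l) auto
  finally show ?thesis .
qed

lemma self_adjoint_add:
  assumes "M \<in> carrier_mat n n" "N \<in> carrier_mat n n" "self_adjoint M" "self_adjoint N"
  shows "self_adjoint (M + N)"
  using assms mat_adjoint_add[of M n n N] by (auto simp: self_adjoint_def)

lemma self_adjoint_minus:
  assumes "M \<in> carrier_mat n n" "N \<in> carrier_mat n n" "self_adjoint M" "self_adjoint N"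
  shows "self_adjoint (M - N)"
  using assms mat_adjoint_minus[of M n n N] by (auto simp: self_adjoint_def)

lemma eigenvalues_nonneg:
  assumes "spectral_decomp n U d M" "\<And>v. v \<in> carrier_vec n \<Longrightarrow> qform M v \<ge> 0" "i < n"
  shows "d i \<ge> 0"
proof -
  have "col U i \<in> carrier_vec n" using spectral_decompD(1)[OF assms(1)] assms(3) by auto
  from assms(2)[OF this] show ?thesis using eigenvalue_qform(1)[OF assms(1,3)] by simp
qed

text \<open>
  Replacing \<open>B\<close> by \<open>T = \<bar>B\<bar>\<close>, termwise in the common eigenbasis \<open>V\<close>, removes the signs: both
  \<open>\<plusminus>(R(A - B) - R(A + B))\<close> are at most \<open>R(A - T) - R(A + T)\<close>. The weights and the eigenvalues of the latter
  are then paired in decreasing order, and the two eigenvalue bounds apply.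
\<close>

lemma resolvent_difference_bound:
  assumes A: "spectral_decomp n U a A" and mono: "\<And>i j. i \<le> j \<Longrightarrow> j < n \<Longrightarrow> a i \<le> a j"
    and B: "spectral_decomp n V b B" and T: "spectral_decomp n V (\<lambda>k. \<bar>b k\<bar>) T" and bs: "\<And>k. k < n \<Longrightarrow> \<bar>b k\<bar> \<le> s"
    and s: "s \<ge> 0" and AT: "\<And>v. v \<in> carrier_vec n \<Longrightarrow> qform T v \<le> qform A v"
    and X: "spectral_decomp n Q x (A + B)" and Y: "spectral_decomp n P y (A - B)"
    and w: "\<And>i j. i \<le> j \<Longrightarrow> j < n \<Longrightarrow> w j \<le> w i" and d: "\<And>k. k < n \<Longrightarrow> \<bar>d k\<bar> \<le> w k"
    and t: "t > 0"
  shows "(\<Sum>k<n. d k * (qform (resolvent t (A - B)) (col V k) - qform (resolvent t (A + B)) (col V k)))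
     \<le> (\<Sum>k<n. w k * (1 / (t + (max (a k) s - s)) - 1 / (t + (max (a k) s + s))))"
proof -
  note cA = spectral_decompD[OF A] and cB = spectral_decompD[OF B] and cT = spectral_decompD[OF T]
  have saT: "self_adjoint A" "self_adjoint T" using spectral_decomp_self_adjoint A T by blast+
  obtain Q0 x0 where X0: "spectral_decomp n Q0 x0 (A + T)"
    using spectral_theorem[OF add_carrier_mat[OF cT(4)] self_adjoint_add[OF cA(4) cT(4) saT]] by blast
  obtain P0 y0 where Y0: "spectral_decomp n P0 y0 (A - T)"
    using spectral_theorem[OF minus_carrier_mat[OF cT(4)] self_adjoint_minus[OF cA(4) cT(4) saT]] by blast
  have qT0: "qform T v \<ge> 0" and qTs: "qform T v \<le> s * sqnorm v"
    and qBT: "qform B v \<le> qform T v" "- qform B v \<le> qform T v" if "v \<in> carrier_vec n" for v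
  proof -
    show "qform T v \<ge> 0" unfolding qform_coord[OF T that] by (intro sum_nonneg) simp
    show "qform T v \<le> s * sqnorm v"
      unfolding qform_coord[OF T that] sqnorm_coord[OF cB(1,2) that] sum_distrib_left
      using bs by (intro sum_mono mult_right_mono) auto
    show "qform B v \<le> qform T v" "- qform B v \<le> qform T v"
      unfolding qform_coord[OF T that] qform_coord[OF B that] sum_negf[symmetric] mult_minus_left[symmetric]
      by (intro sum_mono mult_right_mono; simp)+
  qed
  note q = qform_add[OF cA(4) cT(4)] qform_add[OF cA(4) cB(4)] qform_minus[OF cA(4) cT(4)] qform_minus[OF cA(4) cB(4)]
  have qpos: "qform (A + B) v \<ge> 0" "qform (A - B) v \<ge> 0" "qform (A + T) v \<ge> 0" "qform (A - T) v \<ge> 0"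
    "qform A v \<ge> 0" if "v \<in> carrier_vec n" for v
    unfolding q[OF that] using qT0[OF that] qBT[OF that] AT[OF that] by linarith+
  have qle: "qform (A - B) v \<le> qform (A + T) v" "qform (A + B) v \<le> qform (A + T) v"
    "qform (A - T) v \<le> qform (A - B) v" "qform (A - T) v \<le> qform (A + B) v"
    "qform A v - s * sqnorm v \<le> qform (A - T) v" "qform (A + T) v \<le> qform A v + s * sqnorm v"
    "qform (A + T) v \<le> qform (A - T) v + 2 * s * sqnorm v" if "v \<in> carrier_vec n" for v
    unfolding q[OF that] using qTs[OF that] qBT[OF that] by linarith+
  have pos: "x i \<ge> 0" "y i \<ge> 0" "x0 i \<ge> 0" "y0 i \<ge> 0" "a i \<ge> 0" if "i < n" for i
    using eigenvalues_nonneg[OF X qpos(1) that] eigenvalues_nonneg[OF Y qpos(2) that]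
      eigenvalues_nonneg[OF X0 qpos(3) that] eigenvalues_nonneg[OF Y0 qpos(4) that]
      eigenvalues_nonneg[OF A qpos(5) that] by blast+
  let ?R = "resolvent t"
  note RX0 = spectral_decompD[OF spectral_decomp_resolvent[OF X0, of t]] and RY0 = spectral_decompD[OF spectral_decomp_resolvent[OF Y0, of t]]
  have "self_adjoint (?R (A - T) - ?R (A + T))"
    using self_adjoint_minus[OF RY0(4) RX0(4)] spectral_decomp_self_adjoint spectral_decomp_resolvent X0 Y0 by blast
  then obtain F' l' where "spectral_decomp n F' l' (?R (A - T) - ?R (A + T))"
    using spectral_theorem[OF minus_carrier_mat[OF RX0(4)]] by blast
  then obtain F l where F: "spectral_decomp n F l (?R (A - T) - ?R (A + T))"
    and "\<And>i j. i \<le> j \<Longrightarrow> j < n \<Longrightarrow> - l i \<le> - l j"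
    using spectral_decomp_sorted[of n F' l' _ uminus] by blast
  then have l: "l j \<le> l i" if "i \<le> j" "j < n" for i j using that by force
  have col: "col V k \<in> carrier_vec n" if "k < n" for k using cB(1) that by auto
  have "(\<Sum>k<n. d k * (qform (?R (A - B)) (col V k) - qform (?R (A + B)) (col V k)))
     \<le> (\<Sum>k<n. w k * qform (?R (A - T) - ?R (A + T)) (col V k))"
  proof (intro sum_mono)
    fix k assume "k \<in> {..<n}"
    then have k: "k < n" by simp
    let ?v = "col V k"
    have 1: "qform (?R (A + T)) ?v \<le> qform (?R (A - B)) ?v"
      by (rule resolvent_antimono[OF Y pos(2) X0 pos(3) t qle(1) col[OF k]])
    have 2: "qform (?R (A + T)) ?v \<le> qform (?R (A + B)) ?v"
      by (rule resolvent_antimono[OF X pos(1) X0 pos(3) t qle(2) col[OF k]])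
    have 3: "qform (?R (A - B)) ?v \<le> qform (?R (A - T)) ?v"
      by (rule resolvent_antimono[OF Y0 pos(4) Y pos(2) t qle(3) col[OF k]])
    have 4: "qform (?R (A + B)) ?v \<le> qform (?R (A - T)) ?v"
      by (rule resolvent_antimono[OF Y0 pos(4) X pos(1) t qle(4) col[OF k]])
    have "d k * (qform (?R (A - B)) ?v - qform (?R (A + B)) ?v)
       \<le> \<bar>d k\<bar> * \<bar>qform (?R (A - B)) ?v - qform (?R (A + B)) ?v\<bar>"
      by (metis abs_ge_self abs_mult)
    also have "\<dots> \<le> w k * (qform (?R (A - T)) ?v - qform (?R (A + T)) ?v)"
      using d[OF k] 1 2 3 4 by (intro mult_mono) auto
    finally show "d k * (qform (?R (A - B)) ?v - qform (?R (A + B)) ?v) \<le> w k * qform (?R (A - T) - ?R (A + T)) ?v"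
      using qform_minus[OF RY0(4) RX0(4) col[OF k]] by simp
  qed
  also have "\<dots> \<le> (\<Sum>k<n. w k * l k)" by (rule weighted_trace_le[OF F l cB(1,2) w])
  also have "\<dots> \<le> (\<Sum>k<n. w k * (1 / (t + (max (a k) s - s)) - 1 / (t + (max (a k) s + s))))"
  proof (intro sum_mono mult_left_mono)
    fix k assume "k \<in> {..<n}"
    then have k: "k < n" by simp
    show "w k \<ge> 0" using d[OF k] by linarith
    show "l k \<le> 1 / (t + (max (a k) s - s)) - 1 / (t + (max (a k) s + s))"
    proof (cases "a k \<ge> s")
      case True
      have "l k \<le> 1 / (t + (a k - s)) - 1 / (t + (a k + s))"
        by (rule resolvent_difference_eigenvalue_bound[OF A mono pos(5) s t Y0 pos(4) X0 pos(3) qle(5,6) F l k True])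
      then show ?thesis using True by (simp add: max_def)
    next
      case False
      have "l k \<le> 1 / t - 1 / (t + 2 * s)"
        by (rule resolvent_difference_eigenvalue_cap[OF s t Y0 pos(4) X0 pos(3) qle(7) F k])
      then show ?thesis using False by (simp add: max_def)
    qed
  qed
  finally show ?thesis .
qed

text \<open>
  The integral over \<open>t\<close> of the resolvent bound, with \<open>x / (t + x) = 1 - t / (t + x)\<close>. The constants
  \<open>1\<close> cancel because the overlaps sum to \<open>1\<close>.
\<close>

lemma power_difference_bound:
  fixes r :: real
  assumes r: "0 < r" "r < 1"
    and A: "spectral_decomp n U a A" and mono: "\<And>i j. i \<le> j \<Longrightarrow> j < n \<Longrightarrow> a i \<le> a j"
    and B: "spectral_decomp n V b B" and T: "spectral_decomp n V (\<lambda>k. \<bar>b k\<bar>) T" and bs: "\<And>k. k < n \<Longrightarrow> \<bar>b k\<bar> \<le> s"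
    and s: "s \<ge> 0" and AT: "\<And>v. v \<in> carrier_vec n \<Longrightarrow> qform T v \<le> qform A v"
    and X: "spectral_decomp n Q x (A + B)" "\<And>i. i < n \<Longrightarrow> x i \<ge> 0" and Y: "spectral_decomp n P y (A - B)" "\<And>i. i < n \<Longrightarrow> y i \<ge> 0"
    and w: "\<And>i j. i \<le> j \<Longrightarrow> j < n \<Longrightarrow> w j \<le> w i" and d: "\<And>k. k < n \<Longrightarrow> \<bar>d k\<bar> \<le> w k"
  shows "(\<Sum>k<n. d k * ((\<Sum>i<n. x i powr r * overlap Q V i k) - (\<Sum>i<n. y i powr r * overlap P V i k)))
     \<le> (\<Sum>k<n. w k * ((max (a k) s + s) powr r - (max (a k) s - s) powr r))"
proof -
  note cX = spectral_decompD[OF X(1)] and cY = spectral_decompD[OF Y(1)] and cB = spectral_decompD[OF B]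
  \<comment> \<open>Both sides become single weighted sums of powers; the Boolean tells \<open>A + B\<close> from \<open>A - B\<close>, and \<open>m + s\<close> from \<open>m - s\<close>.\<close>
  define I where "I = {..<n} \<times> {..<n} \<times> (UNIV :: bool set)"
  define J where "J = {..<n} \<times> (UNIV :: bool set)"
  define c where "c = (\<lambda>(k, i, z). if z then d k * overlap Q V i k else - d k * overlap P V i k)"
  define u where "u = (\<lambda>(k :: nat, i, z). if z then x i else y i)"
  define e where "e = (\<lambda>(k, z). if z then w k else - w k)"
  define v where "v = (\<lambda>(k, z). if z then max (a k) s + s else max (a k) s - s)"
  have L: "(\<Sum>q\<in>I. c q * f (u q)) = (\<Sum>k<n. d k * ((\<Sum>i<n. f (x i) * overlap Q V i k) - (\<Sum>i<n. f (y i) * overlap P V i k)))"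
    for f :: "real \<Rightarrow> real"
  proof -
    have "(\<Sum>q\<in>I. c q * f (u q)) = (\<Sum>k<n. \<Sum>i<n. \<Sum>z\<in>UNIV. c (k, i, z) * f (u (k, i, z)))"
      unfolding I_def by (simp add: sum.cartesian_product case_prod_beta)
    also have "\<dots> = (\<Sum>k<n. \<Sum>i<n. d k * (f (x i) * overlap Q V i k) - d k * (f (y i) * overlap P V i k))"
      by (simp add: UNIV_bool c_def u_def mult_ac)
    finally show ?thesis by (simp add: sum_subtractf sum_distrib_left right_diff_distrib)
  qed
  have R: "(\<Sum>q\<in>J. e q * f (v q)) = (\<Sum>k<n. w k * (f (max (a k) s + s) - f (max (a k) s - s)))" for f :: "real \<Rightarrow> real"
  proof -
    have "(\<Sum>q\<in>J. e q * f (v q)) = (\<Sum>k<n. \<Sum>z\<in>UNIV. e (k, z) * f (v (k, z)))"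
      unfolding J_def by (simp add: sum.cartesian_product case_prod_beta)
    then show ?thesis by (simp add: UNIV_bool e_def v_def right_diff_distrib)
  qed
  have "(\<Sum>q\<in>I. c q * u q powr r) \<le> (\<Sum>q\<in>J. e q * v q powr r)"
  proof (rule powr_le_from_resolvent_le[OF r])
    show "u q \<ge> 0" if "q \<in> I" for q using that X(2) Y(2) by (auto simp: I_def u_def)
    show "v q \<ge> 0" if "q \<in> J" for q using that s by (auto simp: J_def v_def)
    fix t :: real assume t: "t > 0"
    have sp: "z / (t + z) = 1 - t * (1 / (t + z))" if "z \<ge> 0" for z using that t by (simp add: field_simps)
    have res: "(\<Sum>i<n. (m i / (t + m i)) * overlap M V i k) = 1 - t * qform (resolvent t Z) (col V k)"
      if Z: "spectral_decomp n M m Z" and m: "\<And>i. i < n \<Longrightarrow> m i \<ge> 0" and k: "k < n" for M m Z k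
    proof -
      note cM = spectral_decompD[OF Z]
      have "(\<Sum>i<n. (m i / (t + m i)) * overlap M V i k)
          = (\<Sum>i<n. overlap M V i k - t * (1 / (t + m i) * overlap M V i k))"
        by (intro sum.cong refl) (simp only: sp m lessThan_iff left_diff_distrib mult_1_left mult.assoc)
      then show ?thesis unfolding sum_subtractf sum_distrib_left[symmetric]
        using qform_col[OF spectral_decomp_resolvent[OF Z] cB(1) k] overlap_sum_left[OF cM(1,2) cB(1,2) k] by simp
    qed
    have "(\<Sum>q\<in>I. c q * (u q / (t + u q)))
       = (\<Sum>k<n. t * (d k * (qform (resolvent t (A - B)) (col V k) - qform (resolvent t (A + B)) (col V k))))"
      unfolding L[of "\<lambda>z. z / (t + z)"]
    proof (intro sum.cong refl)
      fix k assume "k \<in> {..<n}"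
      then have k: "k < n" by simp
      show "d k * ((\<Sum>i<n. x i / (t + x i) * overlap Q V i k) - (\<Sum>i<n. y i / (t + y i) * overlap P V i k))
        = t * (d k * (qform (resolvent t (A - B)) (col V k) - qform (resolvent t (A + B)) (col V k)))"
        using res[OF X(1) X(2) k] res[OF Y(1) Y(2) k] by (simp only:) (simp add: algebra_simps)
    qed
    also have "\<dots> \<le> t * (\<Sum>k<n. w k * (1 / (t + (max (a k) s - s)) - 1 / (t + (max (a k) s + s))))"
      unfolding sum_distrib_left[symmetric]
      using resolvent_difference_bound[OF A mono B T bs s AT X(1) Y(1) w d t] t by (intro mult_left_mono) auto
    also have "\<dots> = (\<Sum>k<n. w k * ((max (a k) s + s) / (t + (max (a k) s + s)) - (max (a k) s - s) / (t + (max (a k) s - s))))"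
      unfolding sum_distrib_left
    proof (intro sum.cong refl)
      fix k
      have "max (a k) s + s \<ge> 0" "max (a k) s - s \<ge> 0" using s by auto
      then show "t * (w k * (1 / (t + (max (a k) s - s)) - 1 / (t + (max (a k) s + s))))
         = w k * ((max (a k) s + s) / (t + (max (a k) s + s)) - (max (a k) s - s) / (t + (max (a k) s - s)))"
        by (simp only: sp) (simp add: right_diff_distrib mult.commute[of t])
    qed
    also have "\<dots> = (\<Sum>q\<in>J. e q * (v q / (t + v q)))" by (rule R[of "\<lambda>z. z / (t + z)", symmetric])
    finally show "(\<Sum>q\<in>I. c q * (u q / (t + u q))) \<le> (\<Sum>q\<in>J. e q * (v q / (t + v q)))" .
  qed
  then show ?thesis unfolding L[of "\<lambda>z. z powr r"] R[of "\<lambda>z. z powr r"] .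
qed

text \<open>
  Klein's inequality for the convex function \<open>x\<^sup>p\<close>: apply the scalar tangent inequality to all pairs of
  eigenvalues and average with the doubly stochastic overlaps of the two eigenbases.
\<close>

lemma trace_power_increment:
  fixes p :: real
  assumes p: "1 < p" and X: "spectral_decomp n Q x X" "\<And>i. i < n \<Longrightarrow> x i \<ge> 0" and Z: "spectral_decomp n P z Z" "\<And>i. i < n \<Longrightarrow> z i \<ge> 0"
    and D: "spectral_decomp n V d D" and XZ: "\<And>v. v \<in> carrier_vec n \<Longrightarrow> qform X v - qform Z v = qform D v"
  shows "(\<Sum>i<n. x i powr p) - (\<Sum>i<n. z i powr p)
     \<le> p * (\<Sum>k<n. d k * (\<Sum>i<n. x i powr (p - 1) * overlap Q V i k))"
proof -
  note cX = spectral_decompD[OF X(1)] and cZ = spectral_decompD[OF Z(1)] and cD = spectral_decompD[OF D]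
  have tan: "x i powr p - z j powr p \<le> p * (x i powr (p - 1) * (x i - z j))" if "i < n" "j < n" for i j
  proof -
    have "signed_powr (p - 1) (x i) = x i powr (p - 1)" using X(2)[OF that(1)] by (auto simp: signed_powr_def sgn_if)
    with abs_powr_tangent[OF p, of "x i" "z j"] show ?thesis
      using X(2)[OF that(1)] Z(2)[OF that(2)] by (simp add: algebra_simps)
  qed
  have "(\<Sum>i<n. x i powr p) = (\<Sum>i<n. \<Sum>j<n. x i powr p * overlap P Q j i)"
    by (simp add: sum_distrib_left[symmetric] overlap_sum_left[OF cZ(1,2) cX(1,2)])
  moreover have "(\<Sum>j<n. z j powr p) = (\<Sum>j<n. \<Sum>i<n. z j powr p * overlap P Q j i)"
    by (simp add: sum_distrib_left[symmetric] overlap_sum_right[OF cZ(1,2) cX(1,2)])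
  ultimately have "(\<Sum>i<n. x i powr p) - (\<Sum>i<n. z i powr p)
      = (\<Sum>i<n. \<Sum>j<n. (x i powr p - z j powr p) * overlap P Q j i)"
    using sum.swap[of "\<lambda>j i. z j powr p * overlap P Q j i" "{..<n}" "{..<n}"]
    by (simp add: left_diff_distrib sum_subtractf)
  also have "\<dots> \<le> (\<Sum>i<n. \<Sum>j<n. p * (x i powr (p - 1) * (x i - z j)) * overlap P Q j i)"
    using tan by (intro sum_mono mult_right_mono) auto
  also have "\<dots> = (\<Sum>i<n. p * x i powr (p - 1) * (x i * (\<Sum>j<n. overlap P Q j i) - (\<Sum>j<n. z j * overlap P Q j i)))"
    by (simp add: sum_distrib_left sum_subtractf algebra_simps)
  also have "\<dots> = (\<Sum>i<n. p * x i powr (p - 1) * (\<Sum>k<n. d k * overlap Q V i k))"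
  proof (intro sum.cong refl)
    fix i assume "i \<in> {..<n}"
    then have i: "i < n" by simp
    have v: "col Q i \<in> carrier_vec n" using cX(1) i by auto
    have "x i * (\<Sum>j<n. overlap P Q j i) - (\<Sum>j<n. z j * overlap P Q j i) = qform X (col Q i) - qform Z (col Q i)"
      using eigenvalue_qform(1)[OF X(1) i] qform_col[OF Z(1) cX(1) i] overlap_sum_left[OF cZ(1,2) cX(1,2) i] by simp
    also have "\<dots> = (\<Sum>k<n. d k * overlap Q V i k)"
      unfolding XZ[OF v] qform_col[OF D cX(1) i] using overlap_commute[OF cX(1) cD(1) i] by simp
    finally show "p * x i powr (p - 1) * (x i * (\<Sum>j<n. overlap P Q j i) - (\<Sum>j<n. z j * overlap P Q j i))
       = p * x i powr (p - 1) * (\<Sum>k<n. d k * overlap Q V i k)" by simp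
  qed
  also have "\<dots> = (\<Sum>i<n. \<Sum>k<n. p * (d k * (x i powr (p - 1) * overlap Q V i k)))"
    by (simp add: sum_distrib_left mult_ac)
  also have "\<dots> = (\<Sum>k<n. \<Sum>i<n. p * (d k * (x i powr (p - 1) * overlap Q V i k)))" by (rule sum.swap)
  also have "\<dots> = p * (\<Sum>k<n. d k * (\<Sum>i<n. x i powr (p - 1) * overlap Q V i k))"
    by (simp add: sum_distrib_left)
  finally show ?thesis .
qed


section \<open>Trace powers, Schatten norms and singular values\<close>

lemma mat_trace_spectral_decomp:
  assumes "spectral_decomp n U d M" shows "Re (mat_trace M) = (\<Sum>i<n. d i)"
proof -
  note c = spectral_decompD[OF assms]
  have "mat_trace M = (\<Sum>i<n. \<Sum>k<n. U $$ (i, k) * complex_of_real (d k) * cnj (U $$ (i, k)))"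
    using c(4) assms[unfolded spectral_decomp_iff_index[OF c(1,2,4)]] unfolding mat_trace_def by simp
  also have "\<dots> = (\<Sum>k<n. \<Sum>i<n. U $$ (i, k) * complex_of_real (d k) * cnj (U $$ (i, k)))" by (rule sum.swap)
  also have "\<dots> = (\<Sum>k<n. complex_of_real (d k))"
  proof (intro sum.cong refl)
    fix k assume "k \<in> {..<n}"
    then have "(\<Sum>i<n. cnj (U $$ (i, k)) * U $$ (i, k)) = 1" using c(2)[unfolded unitary_iff_index[OF c(1)]] by simp
    moreover have "(\<Sum>i<n. U $$ (i, k) * complex_of_real (d k) * cnj (U $$ (i, k)))
        = complex_of_real (d k) * (\<Sum>i<n. cnj (U $$ (i, k)) * U $$ (i, k))"
      unfolding sum_distrib_left by (intro sum.cong) (auto simp: mult_ac)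
    ultimately show "(\<Sum>i<n. U $$ (i, k) * complex_of_real (d k) * cnj (U $$ (i, k))) = complex_of_real (d k)" by simp
  qed
  finally show ?thesis by simp
qed

definition trace_powr :: "real \<Rightarrow> complex mat \<Rightarrow> real" where
  "trace_powr p M = Re (mat_trace (mat_fun (\<lambda>x. x powr p) M))"

lemma trace_powr_spectral_decomp: "spectral_decomp n U d M \<Longrightarrow> trace_powr p M = (\<Sum>i<n. d i powr p)"
  unfolding trace_powr_def by (rule mat_trace_spectral_decomp[OF spectral_decomp_mat_fun])

text \<open>Because \<open>M\<close> is self-adjoint, \<open>M* M = M\<^sup>2\<close> has eigenvalues \<open>d\<^sub>i\<^sup>2\<close>.\<close>

lemma spectral_decomp_mat_abs:
  assumes "spectral_decomp n U d M" shows "spectral_decomp n U (\<lambda>i. \<bar>d i\<bar>) (mat_abs M)"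
proof -
  note c = spectral_decompD[OF assms]
  let ?D = "mat_diag n (\<lambda>i. complex_of_real (d i))"
  have D: "?D \<in> carrier_mat n n" by simp
  have adj: "mat_adjoint M = M" using spectral_decomp_self_adjoint[OF assms] by (simp add: self_adjoint_def)
  note assoc = assoc_mult_mat[of _ n n _ n _ n] mult_carrier_mat[of _ n n]
  have "M * M = U * ?D * ((mat_adjoint U * U) * (?D * mat_adjoint U))"
    using c(1,3) D by (subst (1 2) c(5)) (simp only: assoc)
  also have "\<dots> = U * (?D * ?D) * mat_adjoint U"
    unfolding unitary_mat_cancel[OF c(1,2)] using c(1,3) D
    by (simp only: left_mult_one_mat[of _ n n] assoc)
  finally have "spectral_decomp n U (\<lambda>i. (d i)\<^sup>2) (mat_adjoint M * M)"
    unfolding spectral_decomp_def adj using c(1,2) by (simp add: power2_eq_square)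
  from spectral_decomp_mat_fun[OF this, of sqrt] show ?thesis by (simp add: mat_abs_def)
qed

lemma schatten_norm_powr:
  assumes "spectral_decomp n U d M" "p \<ge> 1"
  shows "schatten_norm p M powr p = (\<Sum>i<n. \<bar>d i\<bar> powr p)"
proof -
  have "Re (mat_trace (mat_fun (\<lambda>x. x powr p) (mat_abs M))) = (\<Sum>i<n. \<bar>d i\<bar> powr p)"
    by (rule mat_trace_spectral_decomp[OF spectral_decomp_mat_fun[OF spectral_decomp_mat_abs[OF assms(1)]]])
  moreover have "(\<Sum>i<n. \<bar>d i\<bar> powr p) \<ge> 0" by (intro sum_nonneg) simp
  ultimately show ?thesis using assms(2) by (simp add: schatten_norm_def powr_powr)
qed

lemma proots_char_poly_spectral_decomp:
  assumes "spectral_decomp n U d M"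
  shows "proots (char_poly M) = mset (map (\<lambda>i. complex_of_real (d i)) [0..<n])"
proof -
  note c = spectral_decompD[OF assms]
  let ?D = "mat_diag n (\<lambda>i. complex_of_real (d i))"
  have D: "?D \<in> carrier_mat n n" by simp
  have "similar_mat_wit M ?D U (mat_adjoint U)"
    by (rule similar_mat_witI[OF unitary_mat_cancel(2)[OF c(1,2)] unitary_mat_cancel(1)[OF c(1,2)] c(5) c(4) D c(1) c(3)])
  then have "char_poly M = char_poly ?D" by (intro char_poly_similar) (auto simp: similar_mat_def)
  also have "\<dots> = (\<Prod>a\<leftarrow>diag_mat ?D. [:- a, 1:])"
    by (rule char_poly_upper_triangular[OF D]) (auto simp: upper_triangular_def mat_diag_def)
  also have "diag_mat ?D = map (\<lambda>i. complex_of_real (d i)) [0..<n]"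
    by (auto simp: diag_mat_def mat_diag_def)
  finally have cp: "char_poly M = (\<Prod>a\<leftarrow>map (\<lambda>i. complex_of_real (d i)) [0..<n]. [:- a, 1:])" .
  have "proots (\<Prod>a\<leftarrow>xs. [:- a, 1:]) = mset xs" for xs :: "complex list"
  proof (induction xs)
    case (Cons a xs)
    have "(\<Prod>a\<leftarrow>xs. [:- a, 1:]) \<noteq> (0 :: complex poly)" by (auto simp: prod_list_zero_iff)
    then show ?case using Cons by (simp add: proots_mult del: mult_pCons_left)
  qed simp
  then show ?thesis unfolding cp .
qed

lemma singular_values_spectral_decomp:
  assumes "spectral_decomp n U d M"
  shows "singular_values M = rev (sort (map (\<lambda>i. \<bar>d i\<bar>) [0..<n]))"
  unfolding singular_values_def proots_char_poly_spectral_decomp[OF spectral_decomp_mat_abs[OF assms]]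
  by (simp add: sorted_list_of_multiset_mset comp_def flip: mset_map)

lemma Sigma_up_spectral_decomp:
  assumes "spectral_decomp n U d M" "\<And>i. i < n \<Longrightarrow> d i \<ge> 0" "\<And>i j. i \<le> j \<Longrightarrow> j < n \<Longrightarrow> d i \<le> d j"
  shows "Sigma_up M = mat_diag n (\<lambda>i. complex_of_real (d (n - Suc i)))"
proof -
  have "sorted (map (\<lambda>i. \<bar>d i\<bar>) [0..<n])" using assms(2,3) by (auto simp: sorted_iff_nth_mono)
  then have "singular_values M = rev (map (\<lambda>i. \<bar>d i\<bar>) [0..<n])"
    unfolding singular_values_spectral_decomp[OF assms(1)] by (simp add: sorted_sort_id)
  then show ?thesis using spectral_decompD(4)[OF assms(1)] assms(2)
    by (auto simp: Sigma_up_def mat_diag_def rev_nth intro!: eq_matI)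
qed

lemma Sigma_down_spectral_decomp:
  assumes "spectral_decomp n U d M" "\<And>i j. i \<le> j \<Longrightarrow> j < n \<Longrightarrow> \<bar>d j\<bar> \<le> \<bar>d i\<bar>"
  shows "Sigma_down M = mat_diag n (\<lambda>i. complex_of_real \<bar>d (n - Suc i)\<bar>)"
proof -
  have "sorted (rev (map (\<lambda>i. \<bar>d i\<bar>) [0..<n]))" using assms(2) by (auto simp: sorted_iff_nth_mono rev_nth)
  then have "sort (map (\<lambda>i. \<bar>d i\<bar>) [0..<n]) = rev (map (\<lambda>i. \<bar>d i\<bar>) [0..<n])"
    by (intro properties_for_sort) simp_all
  then have "singular_values M = map (\<lambda>i. \<bar>d i\<bar>) [0..<n]"
    unfolding singular_values_spectral_decomp[OF assms(1)] by simp
  then show ?thesis using spectral_decompD(4)[OF assms(1)]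
    by (auto simp: Sigma_down_def mat_diag_def rev_nth intro!: eq_matI)
qed

lemma spectral_decomp_diag: "spectral_decomp n (1\<^sub>m n) d (mat_diag n (\<lambda>i. complex_of_real (d i)))"
proof -
  have "mat_adjoint (1\<^sub>m n) = (1\<^sub>m n :: complex mat)" by (intro eq_matI) auto
  then show ?thesis by (simp add: spectral_decomp_def unitary_mat_def left_mult_one_mat[of _ n n] right_mult_one_mat[of _ n n])
qed

lemma spectral_decomp_minus:
  assumes "spectral_decomp n V f M" "spectral_decomp n V g N"
  shows "spectral_decomp n V (\<lambda>k. f k - g k) (M - N)"
proof -
  note M = spectral_decompD[OF assms(1)] and N = spectral_decompD[OF assms(2)]
  show ?thesis
    using assms minus_carrier_mat[OF N(4), of M] carrier_matD[OF M(4)] carrier_matD[OF N(4)]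
    unfolding spectral_decomp_iff_index[OF M(1,2,4)] spectral_decomp_iff_index[OF M(1,2) N(4)]
      spectral_decomp_iff_index[OF M(1,2) minus_carrier_mat[OF N(4)]]
    by (simp add: algebra_simps sum_subtractf)
qed

lemma spectral_decomp_zero:
  assumes "spectral_decomp n V (\<lambda>_. 0) M" shows "M = 0\<^sub>m n n"
proof -
  note c = spectral_decompD[OF assms]
  show ?thesis using assms[unfolded spectral_decomp_iff_index[OF c(1,2,4)]] c(4) by (intro eq_matI) auto
qed

section \<open>Growth of both sides along the cut-off path\<close>

text \<open>
  The right-hand side is \<open>1/p\<close> times the slope in \<open>s\<close> of \<open>\<bar>s + a\<bar>\<^sup>p + \<bar>s - a\<bar>\<^sup>p\<close> for \<open>r = p - 1\<close>. For \<open>a \<ge> s\<close>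
  the two sides are equal; for \<open>a < s\<close> the inequality is subadditivity, as \<open>2s = (s + a) + (s - a)\<close>.
\<close>

lemma powr_difference_le_signed_powr:
  fixes a s r :: real
  assumes "a \<ge> 0" "s \<ge> 0" "0 < r" "r \<le> 1"
  shows "(max a s + s) powr r - (max a s - s) powr r \<le> signed_powr r (s + a) + signed_powr r (s - a)"
proof (cases "a \<ge> s")
  case True
  then show ?thesis using assms by (cases "a + s = 0") (auto simp: signed_powr_def sgn_if max_def add.commute)
next
  case False
  have "(2 * s) powr r \<le> (s + a) powr r + (s - a) powr r"
    using powr_subadditive[of "s + a" "s - a" r] assms False by simp
  then show ?thesis using assms False by (auto simp: signed_powr_def sgn_if max_def)
qed

definition pair_powr :: "real \<Rightarrow> real \<Rightarrow> real \<Rightarrow> real" where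
  "pair_powr p a b = \<bar>b + a\<bar> powr p + \<bar>b - a\<bar> powr p"

lemma pair_powr_tangent:
  assumes "1 < p"
  shows "pair_powr p a b + p * (signed_powr (p - 1) (b + a) + signed_powr (p - 1) (b - a)) * (b' - b) \<le> pair_powr p a b'"
  using abs_powr_tangent[OF assms, of "b + a" "b' + a"] abs_powr_tangent[OF assms, of "b - a" "b' - a"]
  by (simp add: pair_powr_def algebra_simps)

definition cutoff :: "real \<Rightarrow> real \<Rightarrow> real" where
  "cutoff s z = max (- s) (min s z)"

text \<open>
  Along the cut-off path \<open>s \<mapsto> B\<^sub>s\<close> the weights \<open>w\<^sub>k = min \<bar>b\<^sub>k\<bar> s' - min \<bar>b\<^sub>k\<bar> s\<close> of a step from \<open>s\<close> to
  \<open>s'\<close> are decreasing in \<open>k\<close>, as \<open>power_difference_bound\<close> demands. The growth of the left-hand side is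
  controlled by slopes at \<open>s'\<close>, the growth of the right-hand side by slopes at \<open>s\<close>; since slopes increase
  with \<open>s\<close>, the discrepancy has the telescoping form required by \<open>increment_comparison\<close>.
\<close>

lemma trace_power_rearrangement:
  fixes p :: real
  assumes p: "1 < p" "p < 2"
    and A: "spectral_decomp n U a A" and mono: "\<And>i j. i \<le> j \<Longrightarrow> j < n \<Longrightarrow> a i \<le> a j"
    and B: "spectral_decomp n V b B" and bmono: "\<And>i j. i \<le> j \<Longrightarrow> j < n \<Longrightarrow> \<bar>b j\<bar> \<le> \<bar>b i\<bar>"
    and AB: "\<And>v. v \<in> carrier_vec n \<Longrightarrow> qform (mat_abs B) v \<le> qform A v"
  shows "trace_powr p (A + B) + trace_powr p (A - B) \<le> (\<Sum>k<n. pair_powr p (a k) \<bar>b k\<bar>)"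
proof -
  note cA = spectral_decompD[OF A] and cB = spectral_decompD[OF B] and absB = spectral_decomp_mat_abs[OF B]
  define S where "S = (\<Sum>k<n. \<bar>b k\<bar>)"
  have S: "\<bar>b k\<bar> \<le> S" if "k < n" for k unfolding S_def using that by (intro member_le_sum) auto
  have S0: "S \<ge> 0" unfolding S_def by (intro sum_nonneg) simp
  define Bs where "Bs s = mat_fun (cutoff s) B" for s
  have Bs: "spectral_decomp n V (\<lambda>k. cutoff s (b k)) (Bs s)" for s unfolding Bs_def by (rule spectral_decomp_mat_fun[OF B])
  define Ts where "Ts s = mat_fun (\<lambda>z. \<bar>cutoff s z\<bar>) B" for s
  have Ts: "spectral_decomp n V (\<lambda>k. \<bar>cutoff s (b k)\<bar>) (Ts s)" for s unfolding Ts_def by (rule spectral_decomp_mat_fun[OF B])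
  have abs_cutoff: "\<bar>cutoff s z\<bar> = min \<bar>z\<bar> s" if "s \<ge> 0" for s z using that by (auto simp: cutoff_def)
  have AT: "qform (Ts s) v \<le> qform A v" if "s \<ge> 0" "v \<in> carrier_vec n" for s v
  proof -
    have "qform (Ts s) v \<le> qform (mat_abs B) v"
      unfolding qform_coord[OF Ts that(2)] qform_coord[OF absB that(2)] abs_cutoff[OF that(1)]
      by (intro sum_mono mult_right_mono) auto
    then show ?thesis using AB[OF that(2)] by simp
  qed
  have BT: "\<bar>qform (Bs s) v\<bar> \<le> qform (Ts s) v" if "v \<in> carrier_vec n" for s v
    unfolding qform_coord[OF Ts that] qform_coord[OF Bs that]
    by (rule order.trans[OF sum_abs]) (simp add: abs_mult del: index_mult_mat_vec)
  have T0: "qform (Ts s) v \<ge> 0" if "v \<in> carrier_vec n" for s v using BT[OF that, of s] by linarith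
  have a0: "a i \<ge> 0" if "i < n" for i
    by (rule eigenvalues_nonneg[OF A _ that]) (use AT[of 0] T0[of _ 0] in force)
  have saA: "self_adjoint A" using spectral_decomp_self_adjoint[OF A] .
  have "\<forall>s. \<exists>Q x. spectral_decomp n Q x (A + Bs s)"
    using spectral_theorem[OF add_carrier_mat[OF spectral_decompD(4)[OF Bs]] self_adjoint_add[OF cA(4) spectral_decompD(4)[OF Bs] saA spectral_decomp_self_adjoint[OF Bs]]]
    by blast
  then obtain Q x where X: "\<And>s. spectral_decomp n (Q s) (x s) (A + Bs s)" by metis
  have "\<forall>s. \<exists>Q x. spectral_decomp n Q x (A - Bs s)"
    using spectral_theorem[OF minus_carrier_mat[OF spectral_decompD(4)[OF Bs]] self_adjoint_minus[OF cA(4) spectral_decompD(4)[OF Bs] saA spectral_decomp_self_adjoint[OF Bs]]]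
    by blast
  then obtain P y where Y: "\<And>s. spectral_decomp n (P s) (y s) (A - Bs s)" by metis
  note qs = qform_add[OF cA(4) spectral_decompD(4)[OF Bs]] qform_minus[OF cA(4) spectral_decompD(4)[OF Bs]]
  have qpos: "qform (A + Bs s) v \<ge> 0" "qform (A - Bs s) v \<ge> 0" if "s \<ge> 0" "v \<in> carrier_vec n" for s v
    unfolding qs[OF that(2)] using AT[OF that] BT[OF that(2), of s] by linarith+
  have xy0: "x s i \<ge> 0" "y s i \<ge> 0" if "s \<ge> 0" "i < n" for s i
    using eigenvalues_nonneg[OF X qpos(1)[OF that(1)] that(2)] eigenvalues_nonneg[OF Y qpos(2)[OF that(1)] that(2)] by blast+
  define L where "L s = trace_powr p (A + Bs s) + trace_powr p (A - Bs s)" for s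
  define R where "R s = (\<Sum>k<n. pair_powr p (a k) (min \<bar>b k\<bar> s))" for s
  define slope where "slope k s = signed_powr (p - 1) (s + a k) + signed_powr (p - 1) (s - a k)" for k s
  define E where "E s = p * (\<Sum>k<n. slope k s)" for s
  have slope_mono: "slope k s \<le> slope k s'" if "s \<le> s'" for k s s'
    unfolding slope_def using p that by (intro add_mono signed_powr_mono) auto
  have step: "L s' - L s \<le> R s' - R s + (s' - s) * (E s' - E s)" if ss: "0 \<le> s" "s < s'" "s' \<le> S" for s s'
  proof -
    have s': "s' \<ge> 0" using ss by simp
    define d where "d k = cutoff s' (b k) - cutoff s (b k)" for k
    define w where "w k = min \<bar>b k\<bar> s' - min \<bar>b k\<bar> s" for k
    have D: "spectral_decomp n V d (Bs s' - Bs s)" and D': "spectral_decomp n V (\<lambda>k. - d k) (Bs s - Bs s')"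
      using spectral_decomp_minus[OF Bs[of s'] Bs[of s]] spectral_decomp_minus[OF Bs[of s] Bs[of s']] by (simp_all add: d_def[abs_def])
    have dw: "\<bar>d k\<bar> \<le> w k" for k unfolding d_def w_def cutoff_def min_def max_def abs_if using ss by auto
    have w_mono: "w j \<le> w i" if "i \<le> j" "j < n" for i j
      unfolding w_def min_def using bmono[OF that] ss by auto
    have w_bnd: "0 \<le> w k" "w k \<le> s' - s" for k unfolding w_def min_def using ss by auto
    have iX: "(\<Sum>i<n. x s' i powr p) - (\<Sum>i<n. x s i powr p)
        \<le> p * (\<Sum>k<n. d k * (\<Sum>i<n. x s' i powr (p - 1) * overlap (Q s') V i k))"
      by (rule trace_power_increment[OF p(1) X xy0(1)[OF s'] X xy0(1)[OF ss(1)] D])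
         (simp_all add: qs qform_minus[OF spectral_decompD(4)[OF Bs] spectral_decompD(4)[OF Bs]])
    have iY: "(\<Sum>i<n. y s' i powr p) - (\<Sum>i<n. y s i powr p)
        \<le> p * (\<Sum>k<n. - d k * (\<Sum>i<n. y s' i powr (p - 1) * overlap (P s') V i k))"
      by (rule trace_power_increment[OF p(1) Y xy0(2)[OF s'] Y xy0(2)[OF ss(1)] D'])
         (simp_all add: qs qform_minus[OF spectral_decompD(4)[OF Bs] spectral_decompD(4)[OF Bs]])
    have "L s' - L s \<le> p * (\<Sum>k<n. d k * ((\<Sum>i<n. x s' i powr (p - 1) * overlap (Q s') V i k)
        - (\<Sum>i<n. y s' i powr (p - 1) * overlap (P s') V i k)))"
      using iX iY unfolding L_def trace_powr_spectral_decomp[OF X] trace_powr_spectral_decomp[OF Y]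
      by (simp add: right_diff_distrib sum_subtractf sum_negf)
    also have "\<dots> \<le> p * (\<Sum>k<n. w k * ((max (a k) s' + s') powr (p - 1) - (max (a k) s' - s') powr (p - 1)))"
      using p s' abs_cutoff[OF s'] dw w_mono xy0[OF s'] AT[OF s']
      by (intro mult_left_mono power_difference_bound[OF _ _ A mono Bs Ts _ s' _ X _ Y]) auto
    also have "\<dots> \<le> p * (\<Sum>k<n. w k * slope k s')"
      unfolding slope_def using p a0 s' w_bnd
      by (intro mult_left_mono sum_mono powr_difference_le_signed_powr) auto
    also have "\<dots> \<le> R s' - R s + (s' - s) * (E s' - E s)"
    proof -
      have "p * w k * slope k s' \<le> pair_powr p (a k) (min \<bar>b k\<bar> s') - pair_powr p (a k) (min \<bar>b k\<bar> s)
          + (s' - s) * (p * slope k s' - p * slope k s)" for k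
      proof -
        have "p * w k * slope k s \<le> pair_powr p (a k) (min \<bar>b k\<bar> s') - pair_powr p (a k) (min \<bar>b k\<bar> s)"
        proof (cases "w k = 0")
          case True
          then show ?thesis by (simp add: w_def)
        next
          case False
          \<comment> \<open>A coordinate that still moves has reached \<open>s\<close>, so the tangent of \<open>pair_powr p (a k)\<close> is taken at \<open>s\<close>.\<close>
          then have "min \<bar>b k\<bar> s = s" using ss by (auto simp: w_def min_def split: if_splits)
          then show ?thesis using pair_powr_tangent[OF p(1), of "a k" s "min \<bar>b k\<bar> s'"]
            by (simp add: w_def slope_def algebra_simps)
        qed
        moreover have "w k * (p * slope k s' - p * slope k s) \<le> (s' - s) * (p * slope k s' - p * slope k s)"
          using w_bnd slope_mono[of s s' k] ss p by (intro mult_right_mono) auto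
        ultimately show ?thesis by (simp add: algebra_simps)
      qed
      then have "(\<Sum>k<n. p * w k * slope k s') \<le> (\<Sum>k<n. pair_powr p (a k) (min \<bar>b k\<bar> s') - pair_powr p (a k) (min \<bar>b k\<bar> s)
          + (s' - s) * (p * slope k s' - p * slope k s))" by (intro sum_mono)
      then show ?thesis unfolding R_def E_def
        by (simp add: sum.distrib sum_subtractf sum_distrib_left mult.assoc right_diff_distrib)
    qed
    finally show ?thesis .
  qed
  have main: "L S - L 0 \<le> R S - R 0" by (rule increment_comparison[OF S0 step])
  have "L 0 = R 0"
  proof -
    have "cutoff 0 z = 0" for z by (simp add: cutoff_def)
    then have "Bs 0 = 0\<^sub>m n n" using spectral_decomp_zero[of n V "Bs 0"] Bs[of 0] by simp
    then have "A + Bs 0 = A" "A - Bs 0 = A" using cA(4) by auto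
    then have "L 0 = 2 * (\<Sum>k<n. a k powr p)" unfolding L_def by (simp add: trace_powr_spectral_decomp[OF A])
    then show ?thesis using a0 by (simp add: R_def pair_powr_def sum_distrib_left)
  qed
  moreover have "Bs S = B" 
  proof -
    have "U * mat_diag n (\<lambda>k. complex_of_real (f k)) = U * mat_diag n (\<lambda>k. complex_of_real (g k))"
      if "\<And>k. k < n \<Longrightarrow> f k = g k" for f g and U :: "complex mat"
      using that by (intro arg_cong[where f="\<lambda>M. U * M"] eq_matI) (auto simp: mat_diag_def)
    from this[of "\<lambda>k. cutoff S (b k)" b] have "V * mat_diag n (\<lambda>k. complex_of_real (cutoff S (b k))) = V * mat_diag n (\<lambda>k. complex_of_real (b k))"
      using S by (force simp: cutoff_def abs_le_iff)
    then show ?thesis using spectral_decompD(5)[OF Bs, of S] cB(5) by simp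
  qed
  moreover have "R S = (\<Sum>k<n. pair_powr p (a k) \<bar>b k\<bar>)"
    unfolding R_def using S by (intro sum.cong refl) (simp add: min_absorb1)
  ultimately show ?thesis using main by (simp add: L_def)
qed

lemma le_extends_to_closed_interval:
  fixes f g :: "real \<Rightarrow> real"
  assumes "continuous_on {1..2} f" "continuous_on {1..2} g"
    and "\<And>p. 1 < p \<Longrightarrow> p < 2 \<Longrightarrow> f p \<le> g p" and "p \<in> {1..2}"
  shows "f p \<le> g p"
proof -
  have "continuous_on (closure {1<..<2::real}) (\<lambda>p. f p - g p)"
    using assms by (simp add: continuous_on_diff)
  from continuous_le_on_closure[OF this, of p 0] show ?thesis using assms by simp
qed

lemma continuous_on_powr_exponent: "continuous_on S (\<lambda>p::real. (c::real) powr p)"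
  by (cases "c = 0") (auto intro!: continuous_intros)

theorem theorem2p4:
  fixes n :: nat and p :: real and A B :: "complex mat"
  assumes "n \<ge> 1" and "1 \<le> p" and "p \<le> 2"
    and "A \<in> carrier_mat n n" and "B \<in> carrier_mat n n"
    and "self_adjoint A" and "self_adjoint B"
    and "loewner_ge A (mat_abs B)"
  shows "schatten_norm p (A + B) powr p + schatten_norm p (A - B) powr p
       \<le> schatten_norm p (Sigma_up A + Sigma_down B) powr p
         + schatten_norm p (Sigma_up A - Sigma_down B) powr p"
proof -
  obtain U a where A: "spectral_decomp n U a A" and a: "\<And>i j. i \<le> j \<Longrightarrow> j < n \<Longrightarrow> a i \<le> a j"
    using spectral_theorem[OF assms(4,6)] spectral_decomp_sorted[where f="\<lambda>x. x"] by metis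
  obtain V b where B: "spectral_decomp n V b B" and "\<And>i j. i \<le> j \<Longrightarrow> j < n \<Longrightarrow> - \<bar>b i\<bar> \<le> - \<bar>b j\<bar>"
    using spectral_theorem[OF assms(5,7)] spectral_decomp_sorted[where f="\<lambda>x. - \<bar>x\<bar>"] by metis
  then have b: "\<bar>b j\<bar> \<le> \<bar>b i\<bar>" if "i \<le> j" "j < n" for i j using that by force
  note absB = spectral_decomp_mat_abs[OF B]
  have AB: "qform (mat_abs B) v \<le> qform A v" if "v \<in> carrier_vec n" for v
  proof -
    have "0 \<le> qform (A - mat_abs B) v"
      using assms(8) that spectral_decompD(4)[OF absB] unfolding loewner_ge_def psd_def qform_def by auto
    then show ?thesis using qform_minus[OF assms(4) spectral_decompD(4)[OF absB] that] by simp
  qed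
  have qabs: "\<bar>qform B v\<bar> \<le> qform (mat_abs B) v" if "v \<in> carrier_vec n" for v
    unfolding qform_coord[OF B that] qform_coord[OF absB that]
    by (rule order.trans[OF sum_abs]) (simp add: abs_mult del: index_mult_mat_vec)
  obtain Q x where X: "spectral_decomp n Q x (A + B)"
    using spectral_theorem[OF add_carrier_mat[OF assms(5)] self_adjoint_add[OF assms(4-7)]] by blast
  obtain P y where Y: "spectral_decomp n P y (A - B)"
    using spectral_theorem[OF minus_carrier_mat[OF assms(5)] self_adjoint_minus[OF assms(4-7)]] by blast
  have qpos: "qform A v \<ge> 0" "qform (A + B) v \<ge> 0" "qform (A - B) v \<ge> 0" if "v \<in> carrier_vec n" for v
    unfolding qform_add[OF assms(4,5) that] qform_minus[OF assms(4,5) that]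
    using AB[OF that] qabs[OF that] by linarith+
  have a0: "a i \<ge> 0" and x0: "x i \<ge> 0" and y0: "y i \<ge> 0" if "i < n" for i
    using eigenvalues_nonneg[OF A qpos(1) that] eigenvalues_nonneg[OF X qpos(2) that]
      eigenvalues_nonneg[OF Y qpos(3) that] by blast+
  have lhs: "schatten_norm p (A + B) powr p + schatten_norm p (A - B) powr p
      = (\<Sum>i<n. x i powr p) + (\<Sum>i<n. y i powr p)"
    using x0 y0 assms(2) by (simp add: schatten_norm_powr[OF X] schatten_norm_powr[OF Y])
  have up: "Sigma_up A = mat_diag n (\<lambda>i. complex_of_real (a (n - Suc i)))"
    by (rule Sigma_up_spectral_decomp[OF A a0 a])
  have down: "Sigma_down B = mat_diag n (\<lambda>i. complex_of_real \<bar>b (n - Suc i)\<bar>)"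
    by (rule Sigma_down_spectral_decomp[OF B b])
  have plus: "Sigma_up A + Sigma_down B = mat_diag n (\<lambda>i. complex_of_real (a (n - Suc i) + \<bar>b (n - Suc i)\<bar>))"
    and minus: "Sigma_up A - Sigma_down B = mat_diag n (\<lambda>i. complex_of_real (a (n - Suc i) - \<bar>b (n - Suc i)\<bar>))"
    unfolding up down by (auto simp: mat_diag_def intro!: eq_matI)
  have "schatten_norm p (Sigma_up A + Sigma_down B) powr p + schatten_norm p (Sigma_up A - Sigma_down B) powr p
      = (\<Sum>i<n. pair_powr p (a (n - Suc i)) \<bar>b (n - Suc i)\<bar>)"
    unfolding plus minus schatten_norm_powr[OF spectral_decomp_diag assms(2)] pair_powr_def sum.distrib
    by (simp add: add.commute abs_minus_commute)
  also have "\<dots> = (\<Sum>i<n. pair_powr p (a i) \<bar>b i\<bar>)"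
    by (rule sum.nat_diff_reindex)
  finally have rhs: "schatten_norm p (Sigma_up A + Sigma_down B) powr p + schatten_norm p (Sigma_up A - Sigma_down B) powr p
      = (\<Sum>i<n. pair_powr p (a i) \<bar>b i\<bar>)" .
  have "(\<Sum>i<n. x i powr p) + (\<Sum>i<n. y i powr p) \<le> (\<Sum>i<n. pair_powr p (a i) \<bar>b i\<bar>)"
  proof (rule le_extends_to_closed_interval[where f="\<lambda>p. (\<Sum>i<n. x i powr p) + (\<Sum>i<n. y i powr p)"
        and g="\<lambda>p. \<Sum>i<n. pair_powr p (a i) \<bar>b i\<bar>"])
    fix q :: real assume "1 < q" "q < 2"
    then show "(\<Sum>i<n. x i powr q) + (\<Sum>i<n. y i powr q) \<le> (\<Sum>i<n. pair_powr q (a i) \<bar>b i\<bar>)"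
      using trace_power_rearrangement[OF _ _ A a B b AB, of q] by (simp add: trace_powr_spectral_decomp[OF X] trace_powr_spectral_decomp[OF Y])
  qed (use assms in \<open>auto simp: pair_powr_def intro!: continuous_on_add continuous_on_sum continuous_on_powr_exponent\<close>)
  then show ?thesis unfolding lhs rhs .
qed

end
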